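(* Let $\{M(x);x\in\mathbb{R}\}$ be a family of martingales in $\mathcal{M}^2_0$ such that (for the terminal values) $x\mapsto M(x)$ is a.s. in $\mathcal{C}^{1,\delta}(K)$, where $\delta$ and $K$ are positive $\mathbb{F}$-measurable random variables and $K\in L^2(\mathbb{P})$. Let $H\in L^2_0(\mathbb{P})$ and assume that $\mathcal{H}^M$ is closed in $L^2(\mathbb{P})$. Then there exists $\theta^H\in\mathcal{I}^M$ such that $$H=\int M(ds,\theta^H_s)+L^H,$$ where $L^H=H-\int M(ds,\theta^H_s)$ is orthogonal to $\int\frac{\partial}{\partial x}M(ds,\theta^H_s)$, i.e. $$\mathbb{E}\left[\left(H-\int M(ds,\theta^H_s)\right)\int\frac{\partial}{\partial x}M(ds,\theta^H_s)\right]=0.$$ Moreover, $$\left\|H-\int M(ds,\theta^H_s)\right\|_{L^2}=\inf_{X\in\mathcal{H}^M}\|H-X\|_{L^2}.$$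
   Context: Setting. $(\Omega,\mathcal{F},\mathbb{F},\mathbb{P})$ is a filtered probability space: $\mathcal{F}=\{\mathcal{F}_t;t\ge0\}$ is a right-continuous filtration, complete with respect to $\mathbb{P}$, and $\mathbb{F}$ is the smallest $\sigma$-algebra containing all $\mathcal{F}_t$. For all stopping times $T_n\uparrow T$ one assumes $\bigvee_n\mathcal{F}_{T_n}=\mathcal{F}_T$; all adapted martingales are taken to be continuous. $(\Omega,\mathbb{F})$ is separable, so that $L^2(\mathbb{P})$ has a countable basis. Spaces. $L^2(\mathbb{P})$ is the space of $\mathbb{F}$-measurable $Y$ with $\|Y\|_{L^2}^2=\mathbb{E}[Y^2]<\infty$, and $L^2_0(\mathbb{P})=\{X\in L^2(\mathbb{P}):\mathbb{E}[X]=0\}$. $\mathcal{M}^2$ is the set of continuous $\mathcal{F}$-martingales $X$ with $\mathbb{E}[\sup_{t\ge0}X_t^2]<\infty$, and $\mathcal{M}^2_0=\{X\in\mathcal{M}^2:X_0\equiv0\}$. A martingale in $\mathcal{M}^2$ is identified with its terminal value $X=\lim_{t\to\infty}X_t$ a.s.; thus $M(x)=\lim_{t\to\infty}M(t,x)$. $\mathcal{C}^{m,\delta}(K)$ is the set of $m$ times continuously differentiable functions $f:\mathbb{R}\to\mathbb{R}$ with $|f^{(m)}(x)-f^{(m)}(y)|\le K|x-y|^\delta$ for all $x,y$; "a.s. in $\mathcal{C}^{1,\delta}(K)$" with random $\delta,K$ means that for a.e. $\omega$ the function $x\mapsto M(x,\omega)$ is in $\mathcal{C}^{1,\delta(\omega)}(K(\omega))$.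 Stochastic integrals without limits are over $[0,\infty)$. Representation and nonlinear integrals. There is $B\in\mathcal{M}^2_0$ such that every $M(x)$ is a stochastic integral with respect to $B$. Under the stated regularity of $M$, the integrands are taken to be a family of predictable processes $\{\mu(x);x\in\mathbb{R}\}$ with $x\mapsto\mu(t,x)$ a.s. in $\mathcal{C}^1$ for all $t\ge0$, $M(x)=\int\mu(t,x)\,dB_t$ and $\frac{\partial}{\partial x}M(x)=\int\frac{\partial}{\partial x}\mu(t,x)\,dB_t$. For a real-valued predictable process $\theta$, $$\int M(dt,\theta_t)=\int\mu(t,\theta_t)\,dB_t,\qquad \int\frac{\partial}{\partial x}M(dt,\theta_t)=\int\frac{\partial}{\partial x}\mu(t,\theta_t)\,dB_t.$$ Further, $$\mathcal{I}^M=\left\{\theta:\theta\text{ is predictable and }\int M(ds,\theta_s),\ \int\tfrac{\partial}{\partial x}M(ds,\theta_s)\in L^2(\mathbb{P})\right\},$$ $$\mathcal{H}^M=\left\{\int M(ds,\theta_s):\theta\in\mathcal{I}^M\right\}.$$ *)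

theory Defs
  imports "HOL-Probability.Probability"
begin

section \<open>Square-integrable random variables\<close>

text \<open>Random variables are genuine functions; equality in \<open>L\<^sup>2\<close> is almost sure equality.\<close>

definition L2 :: "'a measure \<Rightarrow> ('a \<Rightarrow> real) set" where
  "L2 P = {Y \<in> borel_measurable P. integrable P (\<lambda>\<omega>. (Y \<omega>)\<^sup>2)}"

definition L2_0 :: "'a measure \<Rightarrow> ('a \<Rightarrow> real) set" where
  "L2_0 P = {Y \<in> L2 P. (LINT \<omega>|P. Y \<omega>) = 0}"

definition L2_norm :: "'a measure \<Rightarrow> ('a \<Rightarrow> real) \<Rightarrow> real" where
  "L2_norm P Y = sqrt (LINT \<omega>|P. (Y \<omega>)\<^sup>2)"

definition closed_in_L2 :: "'a measure \<Rightarrow> ('a \<Rightarrow> real) set \<Rightarrow> bool" where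
  "closed_in_L2 P S \<longleftrightarrow>
     (\<forall>X Y. (\<forall>n::nat. X n \<in> S) \<and> Y \<in> L2 P \<and> (\<lambda>n. L2_norm P (\<lambda>\<omega>. X n \<omega> - Y \<omega>)) \<longlonglongrightarrow> 0
        \<longrightarrow> Y \<in> S)"


section \<open>Continuous martingales\<close>

text \<open>Time is \<open>[0,\<infinity>)\<close>: processes and filtrations are indexed by \<open>real\<close>, and their values at negative
  times are never used. Path properties hold almost surely.\<close>

definition continuous_paths :: "'a measure \<Rightarrow> (real \<Rightarrow> 'a \<Rightarrow> real) \<Rightarrow> bool" where
  "continuous_paths P X \<longleftrightarrow> (AE \<omega> in P. continuous_on {0..} (\<lambda>t. X t \<omega>))"

definition martingale :: "'a measure \<Rightarrow> (real \<Rightarrow> 'a measure) \<Rightarrow> (real \<Rightarrow> 'a \<Rightarrow> real) \<Rightarrow> bool" where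
  "martingale P F X \<longleftrightarrow>
     (\<forall>t\<ge>0. X t \<in> borel_measurable (F t) \<and> integrable P (X t)) \<and>
     (\<forall>s\<ge>0. \<forall>t\<ge>s. AE \<omega> in P. real_cond_exp P (F s) (X t) \<omega> = X s \<omega>)"

definition M2 :: "'a measure \<Rightarrow> (real \<Rightarrow> 'a measure) \<Rightarrow> (real \<Rightarrow> 'a \<Rightarrow> real) set" where
  "M2 P F = {X. martingale P F X \<and> continuous_paths P X \<and>
     (\<integral>\<^sup>+\<omega>. (SUP t\<in>{0..}. ennreal ((X t \<omega>)\<^sup>2)) \<partial>P) < \<infinity>}"

definition M2_0 :: "'a measure \<Rightarrow> (real \<Rightarrow> 'a measure) \<Rightarrow> (real \<Rightarrow> 'a \<Rightarrow> real) set" where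
  "M2_0 P F = {X \<in> M2 P F. AE \<omega> in P. X 0 \<omega> = 0}"

definition terminal_value :: "'a measure \<Rightarrow> (real \<Rightarrow> 'a \<Rightarrow> real) \<Rightarrow> ('a \<Rightarrow> real) \<Rightarrow> bool" where
  "terminal_value P X Y \<longleftrightarrow> (AE \<omega> in P. ((\<lambda>t. X t \<omega>) \<longlongrightarrow> Y \<omega>) at_top)"


section \<open>The filtered probability space\<close>

text \<open>Extending the filtration to \<open>[0,\<infinity>]\<close> by the full \<open>\<sigma>\<close>-algebra at \<open>\<infinity>\<close> makes the library notions of
  stopping time and of the \<open>\<sigma>\<close>-algebra of a stopping time cover times with value \<open>\<infinity>\<close>.\<close>

definition extended_filtration :: "'a measure \<Rightarrow> (real \<Rightarrow> 'a measure) \<Rightarrow> ennreal \<Rightarrow> 'a measure" where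
  "extended_filtration P F t = (if t = \<infinity> then P else F (enn2real t))"

text \<open>Separability of the probability space is that of its measure algebra under
  \<open>d(A,C) = P(A \<triangle> C)\<close>, which is equivalent to separability of \<open>L\<^sup>2(P)\<close>.\<close>

locale filtered_prob_space = prob_space P
  for P :: "'a measure" and F :: "real \<Rightarrow> 'a measure" +
  assumes filtration: "filtration (space P) (extended_filtration P F)"
    and generated: "sets P = sigma_sets (space P) (\<Union>t\<in>{0..}. sets (F t))"
    and right_continuous: "\<And>t. 0 \<le> t \<Longrightarrow> (\<Inter>s\<in>{t<..}. sets (F s)) = sets (F t)"
    and complete: "\<And>N A. N \<in> null_sets P \<Longrightarrow> A \<subseteq> N \<Longrightarrow> A \<in> sets (F 0)"
    and no_discontinuity: "\<And>(T :: nat \<Rightarrow> 'a \<Rightarrow> ennreal) T'.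
        (\<And>n. stopping_time (extended_filtration P F) (T n)) \<Longrightarrow>
        stopping_time (extended_filtration P F) T' \<Longrightarrow>
        (\<And>\<omega>. \<omega> \<in> space P \<Longrightarrow> incseq (\<lambda>n. T n \<omega>) \<and> (\<lambda>n. T n \<omega>) \<longlonglongrightarrow> T' \<omega>) \<Longrightarrow>
        sigma_sets (space P)
            (\<Union>n. sets (filtration.pre_sigma (space P) (extended_filtration P F) (T n)))
          = sets (filtration.pre_sigma (space P) (extended_filtration P F) T')"
    and martingales_continuous: "\<And>X. martingale P F X \<Longrightarrow>
        \<exists>Y. martingale P F Y \<and> continuous_paths P Y \<and> (\<forall>t\<ge>0. AE \<omega> in P. X t \<omega> = Y t \<omega>)"
    and separable: "\<exists>C. countable C \<and> C \<subseteq> sets P \<and>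
        (\<forall>A\<in>sets P. \<forall>e>0. \<exists>D\<in>C. measure P ((A - D) \<union> (D - A)) < e)"


section \<open>Predictable processes and the stochastic integral\<close>

definition predictable_sigma :: "'a measure \<Rightarrow> (real \<Rightarrow> 'a measure) \<Rightarrow> (real \<times> 'a) measure" where
  "predictable_sigma P F = sigma ({0..} \<times> space P)
     ({{0} \<times> A |A. A \<in> sets (F 0)} \<union> {{s<..t} \<times> A |s t A. 0 \<le> s \<and> s \<le> t \<and> A \<in> sets (F s)})"

definition predictable :: "'a measure \<Rightarrow> (real \<Rightarrow> 'a measure) \<Rightarrow> (real \<Rightarrow> 'a \<Rightarrow> real) \<Rightarrow> bool" where
  "predictable P F \<theta> \<longleftrightarrow> (\<lambda>(t, \<omega>). \<theta> t \<omega>) \<in> borel_measurable (predictable_sigma P F)"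

text \<open>The Doleans measure \<open>\<nu>(D) = E[\<integral> 1\<^sub>D d\<langle>B\<rangle>]\<close> of \<open>B\<close>, characterised by its values on the generating
  rectangles, where \<open>E[1\<^sub>A (\<langle>B\<rangle>\<^sub>t - \<langle>B\<rangle>\<^sub>s)] = E[1\<^sub>A (B\<^sub>t - B\<^sub>s)\<^sup>2]\<close>.
  These determine it uniquely, and it exists for every \<open>B\<close> in \<open>M2_0\<close>.\<close>

definition doleans_measure ::
    "'a measure \<Rightarrow> (real \<Rightarrow> 'a measure) \<Rightarrow> (real \<Rightarrow> 'a \<Rightarrow> real) \<Rightarrow> (real \<times> 'a) measure \<Rightarrow> bool" where
  "doleans_measure P F B \<nu> \<longleftrightarrow>
     sets \<nu> = sets (predictable_sigma P F) \<and>
     (\<forall>A\<in>sets (F 0). emeasure \<nu> ({0} \<times> A) = 0) \<and>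
     (\<forall>s\<ge>0. \<forall>t\<ge>s. \<forall>A\<in>sets (F s).
        emeasure \<nu> ({s<..t} \<times> A) = (\<integral>\<^sup>+\<omega>. ennreal (indicator A \<omega> * (B t \<omega> - B s \<omega>)\<^sup>2) \<partial>P))"

text \<open>A list entry \<open>(s,t,\<xi>)\<close> encodes the process that is \<open>\<xi>\<close> on \<open>]s,t]\<close> and \<open>0\<close> elsewhere.\<close>

definition elementary :: "'a measure \<Rightarrow> (real \<Rightarrow> 'a measure) \<Rightarrow> (real \<times> real \<times> ('a \<Rightarrow> real)) list \<Rightarrow> bool" where
  "elementary P F es \<longleftrightarrow>
     (\<forall>(s, t, \<xi>) \<in> set es. 0 \<le> s \<and> s \<le> t \<and> \<xi> \<in> borel_measurable (F s) \<and>
        (\<exists>c. \<forall>\<omega>\<in>space P. \<bar>\<xi> \<omega>\<bar> \<le> c))"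

definition elementary_process :: "(real \<times> real \<times> ('a \<Rightarrow> real)) list \<Rightarrow> real \<Rightarrow> 'a \<Rightarrow> real" where
  "elementary_process es u \<omega> = (\<Sum>(s, t, \<xi>)\<leftarrow>es. \<xi> \<omega> * indicator {s<..t} u)"

definition elementary_integral ::
    "(real \<Rightarrow> 'a \<Rightarrow> real) \<Rightarrow> (real \<times> real \<times> ('a \<Rightarrow> real)) list \<Rightarrow> 'a \<Rightarrow> real" where
  "elementary_integral B es \<omega> = (\<Sum>(s, t, \<xi>)\<leftarrow>es. \<xi> \<omega> * (B t \<omega> - B s \<omega>))"

text \<open>\<open>Y\<close> is (a version of) the Ito integral of \<open>f\<close> against \<open>B\<close> over \<open>[0,\<infinity>)\<close>, in the sense of the
  \<open>L\<^sup>2\<close>-isometry. This requires \<open>E[\<integral> f\<^sup>2 d\<langle>B\<rangle>] < \<infinity>\<close>, so that the integral process is in \<open>M2_0\<close>.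
  Measurability with respect to the completion means that \<open>f\<close> is \<open>\<nu>\<close>-a.e. equal to a predictable
  process; in particular \<open>f\<close> may be changed on an evanescent set.\<close>

definition has_stoch_integral ::
    "'a measure \<Rightarrow> (real \<Rightarrow> 'a measure) \<Rightarrow> (real \<Rightarrow> 'a \<Rightarrow> real) \<Rightarrow> (real \<Rightarrow> 'a \<Rightarrow> real) \<Rightarrow> ('a \<Rightarrow> real) \<Rightarrow> bool"
  where
  "has_stoch_integral P F B f Y \<longleftrightarrow>
     Y \<in> L2 P \<and>
     (\<exists>\<nu>. doleans_measure P F B \<nu> \<and>
        (\<lambda>(t, \<omega>). f t \<omega>) \<in> borel_measurable (completion \<nu>) \<and>
        (\<exists>es :: nat \<Rightarrow> (real \<times> real \<times> ('a \<Rightarrow> real)) list.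
           (\<forall>n. elementary P F (es n)) \<and>
           (\<lambda>n. \<integral>\<^sup>+(t, \<omega>). ennreal ((f t \<omega> - elementary_process (es n) t \<omega>)\<^sup>2) \<partial>completion \<nu>)
              \<longlonglongrightarrow> 0 \<and>
           (\<lambda>n. L2_norm P (\<lambda>\<omega>. Y \<omega> - elementary_integral B (es n) \<omega>)) \<longlonglongrightarrow> 0))"

definition stoch_integrable ::
    "'a measure \<Rightarrow> (real \<Rightarrow> 'a measure) \<Rightarrow> (real \<Rightarrow> 'a \<Rightarrow> real) \<Rightarrow> (real \<Rightarrow> 'a \<Rightarrow> real) \<Rightarrow> bool" where
  "stoch_integrable P F B f \<longleftrightarrow> (\<exists>Y. has_stoch_integral P F B f Y)"

definition stoch_integral ::
    "'a measure \<Rightarrow> (real \<Rightarrow> 'a measure) \<Rightarrow> (real \<Rightarrow> 'a \<Rightarrow> real) \<Rightarrow> (real \<Rightarrow> 'a \<Rightarrow> real) \<Rightarrow> 'a \<Rightarrow> real" where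
  "stoch_integral P F B f = (SOME Y. has_stoch_integral P F B f Y)"


section \<open>Nonlinear stochastic integrals\<close>

definition C_class :: "nat \<Rightarrow> (real \<Rightarrow> real) \<Rightarrow> bool" where
  "C_class m f \<longleftrightarrow>
     (\<forall>k<m. \<forall>x. (deriv ^^ k) f differentiable (at x)) \<and> continuous_on UNIV ((deriv ^^ m) f)"

definition Hoelder_class :: "nat \<Rightarrow> real \<Rightarrow> real \<Rightarrow> (real \<Rightarrow> real) set" where
  "Hoelder_class m \<delta> K =
     {f. C_class m f \<and> (\<forall>x y. \<bar>(deriv ^^ m) f x - (deriv ^^ m) f y\<bar> \<le> K * \<bar>x - y\<bar> powr \<delta>)}"

text \<open>\<open>\<mu> x t \<omega>\<close> is the integrand that represents \<open>M(x)\<close> with respect to \<open>B\<close>.\<close>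

definition nl_integrand :: "(real \<Rightarrow> real \<Rightarrow> 'a \<Rightarrow> real) \<Rightarrow> (real \<Rightarrow> 'a \<Rightarrow> real) \<Rightarrow> real \<Rightarrow> 'a \<Rightarrow> real" where
  "nl_integrand \<mu> \<theta> t \<omega> = \<mu> (\<theta> t \<omega>) t \<omega>"

definition dx :: "(real \<Rightarrow> real \<Rightarrow> 'a \<Rightarrow> real) \<Rightarrow> real \<Rightarrow> real \<Rightarrow> 'a \<Rightarrow> real" where
  "dx \<mu> x t \<omega> = deriv (\<lambda>y. \<mu> y t \<omega>) x"

definition nl_integral ::
    "'a measure \<Rightarrow> (real \<Rightarrow> 'a measure) \<Rightarrow> (real \<Rightarrow> 'a \<Rightarrow> real) \<Rightarrow> (real \<Rightarrow> real \<Rightarrow> 'a \<Rightarrow> real) \<Rightarrow>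
     (real \<Rightarrow> 'a \<Rightarrow> real) \<Rightarrow> 'a \<Rightarrow> real" where
  "nl_integral P F B \<mu> \<theta> = stoch_integral P F B (nl_integrand \<mu> \<theta>)"

definition admissible ::
    "'a measure \<Rightarrow> (real \<Rightarrow> 'a measure) \<Rightarrow> (real \<Rightarrow> 'a \<Rightarrow> real) \<Rightarrow> (real \<Rightarrow> real \<Rightarrow> 'a \<Rightarrow> real) \<Rightarrow>
     (real \<Rightarrow> 'a \<Rightarrow> real) set" where
  "admissible P F B \<mu> =
     {\<theta>. predictable P F \<theta> \<and> stoch_integrable P F B (nl_integrand \<mu> \<theta>) \<and>
         stoch_integrable P F B (nl_integrand (dx \<mu>) \<theta>)}"

definition nl_range ::
    "'a measure \<Rightarrow> (real \<Rightarrow> 'a measure) \<Rightarrow> (real \<Rightarrow> 'a \<Rightarrow> real) \<Rightarrow> (real \<Rightarrow> real \<Rightarrow> 'a \<Rightarrow> real) \<Rightarrow>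
     ('a \<Rightarrow> real) set" where
  "nl_range P F B \<mu> =
     {X \<in> L2 P. \<exists>\<theta>\<in>admissible P F B \<mu>. AE \<omega> in P. X \<omega> = nl_integral P F B \<mu> \<theta> \<omega>}"

end

theory Submission
  imports Defs
begin

text \<open>By the Ito isometry, \<open>\<H>\<^sup>M\<close> is isometric to the set of all \<open>\<mu>(\<theta>)\<close>, \<open>\<theta> \<in> \<I>\<^sup>M\<close>, in
  \<open>L\<^sup>2(\<nu>)\<close>, where \<open>\<nu>\<close> is the finite Doleans measure of \<open>B\<close> on the predictable \<open>\<sigma>\<close>-algebra. This set is not
  convex in any obvious way, but it is closed and decomposable: two parameters may be glued
  together along a predictable set. A closed decomposable set contains a nearest point to every
  \<open>h\<close> in \<open>L\<^sup>2(\<nu>)\<close>, and we take for \<open>h\<close> the integrand of the projection of \<open>H\<close> onto the space of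
  stochastic integrals. Perturbing the minimiser \<open>\<theta>\<close> by small constants on suitable predictable
  sets shows that \<open>(h - \<mu>(\<theta>)) \<partial>\<^sub>x\<mu>(\<theta>) = 0\<close> holds \<open>\<nu>\<close>-almost everywhere, which is stronger than the
  orthogonality relation.\<close>

section \<open>The space \<open>L\<^sup>2\<close>\<close>

text \<open>The closedness hypothesis lives in L2(P), while gluing along predictable sets and
  pointwise variation make sense only for integrands. The transfer between the two sides needs the
  isometry to be onto: every element of L2(nu) must possess an Ito integral. \<open>H\<close> itself
  need not be a stochastic integral against \<open>B\<close>. Its projection \<open>Y\<close> is
  one, with integrand h, and H - Y is orthogonal to all of them. So squared distances from H to
  stochastic integrals exceed those from h to the integrands by the constant norm of H - Y squared,
  and in the orthogonality relation H may be replaced by Y. Moving theta by a constant everywhere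
  can leave the admissible class, because the values at the shifted parameter need not be square
  integrable. Hence the perturbation is confined to sets where these values are bounded, and
  finiteness of nu makes bounded functions square integrable. Smoothness in x holds only off a
  P-null set of omega. Completeness of the filtration makes the product of this set with the time
  axis predictable and nu-null, so the family can be set to 0 there.\<close>

lemma L2_measurable [measurable_dest]: "f \<in> L2 M \<Longrightarrow> f \<in> borel_measurable M"
  by (simp add: L2_def)

lemma L2_integrable_square: "f \<in> L2 M \<Longrightarrow> integrable M (\<lambda>x. (f x)\<^sup>2)"
  by (simp add: L2_def)

lemma L2_mult_integrable:
  assumes "f \<in> L2 M" "g \<in> L2 M"
  shows "integrable M (\<lambda>x. f x * g x)"
proof (rule Bochner_Integration.integrable_bound)
  show "integrable M (\<lambda>x. (f x)\<^sup>2 + (g x)\<^sup>2)"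
    using assms by (auto intro: L2_integrable_square)
  show "(\<lambda>x. f x * g x) \<in> borel_measurable M"
    using assms[THEN L2_measurable] by measurable
  have "\<bar>a * b\<bar> \<le> a\<^sup>2 + b\<^sup>2" for a b :: real
    using sum_squares_bound[of a b] sum_squares_bound[of a "-b"] by (auto simp: abs_if)
  then show "AE x in M. norm (f x * g x) \<le> norm ((f x)\<^sup>2 + (g x)\<^sup>2)"
    by auto
qed

lemma L2_bounded_by:
  assumes "g \<in> L2 M" "f \<in> borel_measurable M" "AE x in M. \<bar>f x\<bar> \<le> \<bar>g x\<bar>"
  shows "f \<in> L2 M"
proof -
  have "integrable M (\<lambda>x. (f x)\<^sup>2)"
  proof (rule Bochner_Integration.integrable_bound[OF L2_integrable_square[OF assms(1)]])
    show "AE x in M. norm ((f x)\<^sup>2) \<le> norm ((g x)\<^sup>2)"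
      using assms(3) by eventually_elim (simp add: abs_le_square_iff)
  qed (use assms(2) in measurable)
  then show ?thesis
    using assms(2) by (simp add: L2_def)
qed

lemma L2_scale: "f \<in> L2 M \<Longrightarrow> (\<lambda>x. c * f x) \<in> L2 M"
  by (auto simp: L2_def power_mult_distrib)

lemma L2_add:
  assumes "f \<in> L2 M" "g \<in> L2 M"
  shows "(\<lambda>x. f x + g x) \<in> L2 M"
proof -
  have "integrable M (\<lambda>x. (f x)\<^sup>2 + (g x)\<^sup>2 + 2 * (f x * g x))"
    by (intro Bochner_Integration.integrable_add integrable_mult_right L2_integrable_square
        L2_mult_integrable assms)
  then show ?thesis
    using assms[THEN L2_measurable] by (simp add: L2_def power2_sum algebra_simps)
qed

lemma L2_diff:
  assumes "f \<in> L2 M" "g \<in> L2 M"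
  shows "(\<lambda>x. f x - g x) \<in> L2 M"
  using L2_add[OF assms(1) L2_scale[OF assms(2), of "-1"]] by simp

lemma L2_zero: "(\<lambda>x. 0) \<in> L2 M"
  by (simp add: L2_def)

lemma L2_abs: "f \<in> L2 M \<Longrightarrow> (\<lambda>x. \<bar>f x\<bar>) \<in> L2 M"
  by (auto simp: L2_def)

lemma L2_bounded:
  assumes "finite_measure M" "f \<in> borel_measurable M" "\<And>x. x \<in> space M \<Longrightarrow> \<bar>f x\<bar> \<le> c"
  shows "f \<in> L2 M"
proof (rule L2_bounded_by)
  interpret finite_measure M by fact
  show "(\<lambda>x. c) \<in> L2 M" by (simp add: L2_def)
  show "AE x in M. \<bar>f x\<bar> \<le> \<bar>c\<bar>"
    using assms(3) by (intro AE_I2) fastforce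
qed fact

lemma L2_cong_AE:
  assumes "f \<in> L2 M" "g \<in> borel_measurable M" "AE x in M. f x = g x"
  shows "g \<in> L2 M"
  by (rule L2_bounded_by[OF assms(1,2)]) (use assms(3) in auto)

lemma L2_norm_nonneg [simp]: "0 \<le> L2_norm M f"
  by (simp add: L2_norm_def)

lemma L2_norm_sq: "(L2_norm M f)\<^sup>2 = (LINT x|M. (f x)\<^sup>2)"
  by (simp add: L2_norm_def)

lemma L2_norm_minus_commute: "L2_norm M (\<lambda>x. f x - g x) = L2_norm M (\<lambda>x. g x - f x)"
  by (simp add: L2_norm_def power2_commute)

lemma L2_norm_scale: "L2_norm M (\<lambda>x. c * f x) = \<bar>c\<bar> * L2_norm M f"
  by (simp add: L2_norm_def power_mult_distrib real_sqrt_mult)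

lemma L2_norm_cong_AE:
  assumes "f \<in> borel_measurable M" "g \<in> borel_measurable M" "AE x in M. f x = g x"
  shows "L2_norm M f = L2_norm M g"
  unfolding L2_norm_def
  using assms by (intro arg_cong[of _ _ sqrt] integral_cong_AE) auto

lemma L2_norm_eq_0_iff:
  assumes "f \<in> L2 M"
  shows "L2_norm M f = 0 \<longleftrightarrow> (AE x in M. f x = 0)"
  unfolding L2_norm_def
  using integral_nonneg_eq_0_iff_AE[OF L2_integrable_square[OF assms]] by simp

lemma L2_norm_add_sq:
  assumes "f \<in> L2 M" "g \<in> L2 M"
  shows "(L2_norm M (\<lambda>x. f x + g x))\<^sup>2
    = (L2_norm M f)\<^sup>2 + (L2_norm M g)\<^sup>2 + 2 * (LINT x|M. f x * g x)"
proof -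
  have "(LINT x|M. (f x + g x)\<^sup>2) = (LINT x|M. (f x)\<^sup>2 + (g x)\<^sup>2 + 2 * (f x * g x))"
    by (simp add: power2_sum algebra_simps)
  also have "\<dots> = (LINT x|M. (f x)\<^sup>2) + (LINT x|M. (g x)\<^sup>2) + 2 * (LINT x|M. f x * g x)"
    using assms
    by (simp add: L2_integrable_square L2_mult_integrable)
  finally show ?thesis by (simp add: L2_norm_sq)
qed

lemma L2_norm_diff_sq:
  assumes "f \<in> L2 M" "g \<in> L2 M"
  shows "(L2_norm M (\<lambda>x. f x - g x))\<^sup>2
    = (L2_norm M f)\<^sup>2 + (L2_norm M g)\<^sup>2 - 2 * (LINT x|M. f x * g x)"
  using L2_norm_add_sq[OF assms(1) L2_scale[OF assms(2), of "-1"]] L2_norm_scale[of M "-1" g]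
  by simp

lemma L2_Cauchy_Schwarz:
  assumes "f \<in> L2 M" "g \<in> L2 M"
  shows "\<bar>LINT x|M. f x * g x\<bar> \<le> L2_norm M f * L2_norm M g"
proof -
  let ?a = "L2_norm M f" and ?b = "L2_norm M g" and ?c = "LINT x|M. f x * g x"
  have *: "0 \<le> (s * ?a)\<^sup>2 + (t * ?b)\<^sup>2 + 2 * (s * t * ?c)" for s t
  proof -
    have "0 \<le> (L2_norm M (\<lambda>x. s * f x + t * g x))\<^sup>2" by simp
    also have "\<dots> = (s * ?a)\<^sup>2 + (t * ?b)\<^sup>2 + 2 * (LINT x|M. (s * f x) * (t * g x))"
      by (subst L2_norm_add_sq) (auto intro: L2_scale assms simp: L2_norm_scale power_mult_distrib)
    also have "(LINT x|M. (s * f x) * (t * g x)) = (LINT x|M. (s * t) * (f x * g x))"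
      by (simp add: algebra_simps)
    finally show ?thesis by simp
  qed
  have "?c\<^sup>2 \<le> (?a * ?b)\<^sup>2"
  proof (cases "?a = 0 \<and> ?b = 0")
    case True
    then show ?thesis using *[of 1 1] *[of 1 "-1"] by auto
  next
    case False
    \<comment> \<open>These substitutions into the quadratic form leave the wanted difference times
      the square of one norm. Both are made because only one of the two norms is known to be
      nonzero.\<close>
    have 1: "0 \<le> ?b\<^sup>2 * ((?a * ?b)\<^sup>2 - ?c\<^sup>2)"
      using *[of "?b\<^sup>2" "- ?c"] by (simp add: power2_eq_square algebra_simps)
    have 2: "0 \<le> ?a\<^sup>2 * ((?a * ?b)\<^sup>2 - ?c\<^sup>2)"
      using *[of "- ?c" "?a\<^sup>2"] by (simp add: power2_eq_square algebra_simps)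
    show ?thesis
      using 1 2 False by (auto simp: zero_le_mult_iff)
  qed
  then show ?thesis
    by (simp add: abs_le_square_iff[symmetric] abs_mult)
qed

lemma L2_norm_triangle:
  assumes "f \<in> L2 M" "g \<in> L2 M"
  shows "L2_norm M (\<lambda>x. f x + g x) \<le> L2_norm M f + L2_norm M g"
proof (rule power2_le_imp_le)
  show "(L2_norm M (\<lambda>x. f x + g x))\<^sup>2 \<le> (L2_norm M f + L2_norm M g)\<^sup>2"
    using L2_norm_add_sq[OF assms] L2_Cauchy_Schwarz[OF assms] by (simp add: power2_sum)
qed simp

lemma L2_norm_triangle_diff:
  assumes "f \<in> L2 M" "g \<in> L2 M" "h \<in> L2 M"
  shows "L2_norm M (\<lambda>x. f x - h x) \<le> L2_norm M (\<lambda>x. f x - g x) + L2_norm M (\<lambda>x. g x - h x)"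
  using L2_norm_triangle[OF L2_diff[OF assms(1,2)] L2_diff[OF assms(2,3)]] by simp

lemma L2_norm_mono:
  assumes "f \<in> L2 M" "g \<in> L2 M" "AE x in M. \<bar>f x\<bar> \<le> \<bar>g x\<bar>"
  shows "L2_norm M f \<le> L2_norm M g"
  unfolding L2_norm_def
  using assms by (intro real_sqrt_le_mono integral_mono_AE) (auto intro: L2_integrable_square simp: abs_le_square_iff)

lemma nn_integral_square_L2:
  assumes "f \<in> L2 M"
  shows "(\<integral>\<^sup>+x. ennreal ((f x)\<^sup>2) \<partial>M) = ennreal ((L2_norm M f)\<^sup>2)"
  unfolding L2_norm_sq
  by (rule nn_integral_eq_integral) (auto intro: L2_integrable_square assms)

lemma L2_if_nn_integral:
  assumes "f \<in> borel_measurable M" "(\<integral>\<^sup>+x. ennreal ((f x)\<^sup>2) \<partial>M) < \<infinity>"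
  shows "f \<in> L2 M"
  using assms by (auto simp: L2_def intro!: integrableI_nonneg)

section \<open>Completeness of L2, dominated convergence and orthogonal projection\<close>

lemma ennreal_le_suminf: "f k \<le> (\<Sum>k. f k)" for f :: "nat \<Rightarrow> ennreal"
  using sum_le_suminf[of f "{k}"] by simp

lemma L2_complete:
  fixes X :: "nat \<Rightarrow> 'a \<Rightarrow> real"
  assumes X: "\<And>n. X n \<in> L2 M"
    and Cauchy: "\<And>e. 0 < e \<Longrightarrow> \<exists>N. \<forall>m\<ge>N. \<forall>n\<ge>N. L2_norm M (\<lambda>x. X m x - X n x) < e"
  shows "\<exists>Y\<in>L2 M. (\<lambda>n. L2_norm M (\<lambda>x. X n x - Y x)) \<longlonglongrightarrow> 0"
proof -
  note [measurable] = X[THEN L2_measurable]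
  \<comment> \<open>Along a subsequence whose \<open>k\<close>-th increment has squared norm at most \<open>8\<^sup>-\<^sup>k\<close>, the series of the
    squared increments weighted by \<open>4\<^sup>k\<close> is integrable, so almost everywhere the increments decay
    like \<open>2\<^sup>-\<^sup>k\<close>.\<close>
  have "\<exists>N. \<forall>m\<ge>N. \<forall>n\<ge>N. L2_norm M (\<lambda>x. X m x - X n x) < sqrt ((1/8)^k)" for k :: nat
    by (rule Cauchy) simp
  then obtain N where N: "\<And>k m n. N k \<le> m \<Longrightarrow> N k \<le> n \<Longrightarrow> L2_norm M (\<lambda>x. X m x - X n x) < sqrt ((1/8)^k)"
    by metis
  \<comment> \<open>Adding \<open>k\<close> and summing the thresholds makes \<open>r\<close>
    monotone, unbounded and at least \<open>N k\<close> in one formula.\<close>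
  define r where "r k = k + (\<Sum>i\<le>k. N i)" for k
  have rN: "N k \<le> r k" for k
    unfolding r_def by (simp add: member_le_sum trans_le_add2)
  have r_ge: "k \<le> r k" for k by (simp add: r_def)
  have r_mono: "r k \<le> r (Suc k)" for k by (simp add: r_def)
  define D where "D k x = X (r (Suc k)) x - X (r k) x" for k x
  have DL2: "D k \<in> L2 M" for k unfolding D_def by (intro L2_diff X)
  note [measurable] = DL2[THEN L2_measurable]
  have Dn: "(L2_norm M (D k))\<^sup>2 \<le> (1/8)^k" for k
  proof -
    have "L2_norm M (D k) \<le> sqrt ((1/8)^k)"
      unfolding D_def using rN[of k] r_mono[of k] by (intro less_imp_le[OF N]) auto
    then have "(L2_norm M (D k))\<^sup>2 \<le> (sqrt ((1/8)^k))\<^sup>2"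
      by (intro power_mono) auto
    then show ?thesis by simp
  qed
  have "(\<integral>\<^sup>+x. (\<Sum>k. ennreal (4^k * (D k x)\<^sup>2)) \<partial>M) = (\<Sum>k. \<integral>\<^sup>+x. ennreal (4^k * (D k x)\<^sup>2) \<partial>M)"
    by (rule nn_integral_suminf) measurable
  also have "\<dots> \<le> (\<Sum>k. ennreal ((1/2)^k))"
  proof (rule suminf_le)
    fix k
    have "(\<integral>\<^sup>+x. ennreal (4^k * (D k x)\<^sup>2) \<partial>M) = ennreal (4^k) * (\<integral>\<^sup>+x. ennreal ((D k x)\<^sup>2) \<partial>M)"
      by (subst nn_integral_cmult[symmetric]) (auto simp: ennreal_mult)
    also have "\<dots> = ennreal (4^k * (L2_norm M (D k))\<^sup>2)"
      by (simp add: nn_integral_square_L2[OF DL2] ennreal_mult)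
    also have "\<dots> \<le> ennreal (4^k * (1/8)^k)"
      by (intro ennreal_leI mult_left_mono Dn) simp
    also have "(4::real)^k * (1/8)^k = (1/2)^k"
      by (simp add: power_mult_distrib[symmetric])
    finally show "(\<integral>\<^sup>+x. ennreal (4^k * (D k x)\<^sup>2) \<partial>M) \<le> ennreal ((1/2)^k)" .
  qed auto
  also have "\<dots> = ennreal (\<Sum>k. (1/2)^k)"
    by (rule suminf_ennreal2) (auto intro: summable_geometric)
  also have "\<dots> < \<infinity>" by simp
  finally have "AE x in M. (\<Sum>k. ennreal (4^k * (D k x)\<^sup>2)) \<noteq> \<infinity>"
    by (intro nn_integral_PInf_AE) auto
  then have AEconv: "AE x in M. convergent (\<lambda>k. X (r k) x)"
  proof eventually_elim
    case (elim x)
    let ?S = "\<Sum>k. ennreal (4^k * (D k x)\<^sup>2)"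
    define C where "C = enn2real ?S"
    have bound: "\<bar>D k x\<bar> \<le> sqrt C * (1/2)^k" for k
    proof -
      have 1: "ennreal (4^k * (D k x)\<^sup>2) \<le> ?S"
        by (rule ennreal_le_suminf)
      have 2: "?S = ennreal C"
        using elim by (simp add: C_def less_top)
      have 3: "0 \<le> C" by (simp add: C_def)
      have 4: "4^k * (D k x)\<^sup>2 \<le> C" using 1 3 unfolding 2 by (subst (asm) ennreal_le_iff) auto
      have 5: "sqrt (4^k * (D k x)\<^sup>2) \<le> sqrt C" using 4 by (rule real_sqrt_le_mono)
      have 6: "(4::real)^k = (2^k)\<^sup>2"
        by (simp add: power2_eq_square flip: power_mult_distrib)
      have 7: "2^k * \<bar>D k x\<bar> \<le> sqrt C" using 5 unfolding 6
        by (simp add: real_sqrt_mult)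
      show ?thesis
        using 7 by (simp add: field_simps power_one_over)
    qed
    have "summable (\<lambda>k. D k x)"
      by (rule summable_comparison_test'[of "\<lambda>k. sqrt C * (1/2)^k"]) (use bound in \<open>auto intro: summable_mult summable_geometric\<close>)
    then have "convergent (\<lambda>n. \<Sum>k<n. D k x)"
      unfolding summable_iff_convergent .
    moreover have "(\<Sum>k<n. D k x) = X (r n) x - X (r 0) x" for n
      unfolding D_def by (rule sum_lessThan_telescope)
    ultimately have "convergent (\<lambda>n. X (r n) x - X (r 0) x)" by simp
    from convergent_add[OF this convergent_const[of "X (r 0) x"]] show ?case by simp
  qed
  define Y where "Y x = lim (\<lambda>k. X (r k) x)" for x
  have [measurable]: "Y \<in> borel_measurable M"
    unfolding Y_def by measurable
  have lim: "AE x in M. (\<lambda>k. X (r k) x) \<longlonglongrightarrow> Y x"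
    using AEconv by eventually_elim (simp add: Y_def convergent_LIMSEQ_iff)
  \<comment> \<open>Fatou's lemma along the subsequence carries the Cauchy bound over to the
    distance from \<open>X n\<close> to the limit. It serves twice: with bound 1 at
    \<open>N 0\<close> for membership of \<open>Y\<close> in L2, and with bound \<open>e/2\<close>
    for convergence of the whole sequence.\<close>
  have est: "(\<integral>\<^sup>+x. ennreal ((X n x - Y x)\<^sup>2) \<partial>M) \<le> ennreal (e\<^sup>2)"
    if NN: "\<And>m. N0 \<le> m \<Longrightarrow> L2_norm M (\<lambda>x. X n x - X m x) < e" and "0 < e" for e N0 n
  proof -
    have "(\<integral>\<^sup>+x. ennreal ((X n x - Y x)\<^sup>2) \<partial>M) = (\<integral>\<^sup>+x. liminf (\<lambda>k. ennreal ((X n x - X (r k) x)\<^sup>2)) \<partial>M)"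
    proof (rule nn_integral_cong_AE, use lim in eventually_elim)
      case (elim x)
      have "(\<lambda>k. ennreal ((X n x - X (r k) x)\<^sup>2)) \<longlonglongrightarrow> ennreal ((X n x - Y x)\<^sup>2)"
        by (intro tendsto_intros elim)
      from lim_imp_Liminf[OF trivial_limit_sequentially this] show ?case
        by (rule sym)
    qed
    also have "\<dots> \<le> liminf (\<lambda>k. \<integral>\<^sup>+x. ennreal ((X n x - X (r k) x)\<^sup>2) \<partial>M)"
      by (rule nn_integral_liminf) measurable
    also have "\<dots> \<le> ennreal (e\<^sup>2)"
    proof (rule order_trans[OF Liminf_le_Limsup Limsup_bounded[OF eventually_sequentiallyI]])
      fix k assume "N0 \<le> k"
      then have "L2_norm M (\<lambda>x. X n x - X (r k) x) \<le> e"
        using NN[of "r k"] r_ge[of k] by simp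
      then show "(\<integral>\<^sup>+x. ennreal ((X n x - X (r k) x)\<^sup>2) \<partial>M) \<le> ennreal (e\<^sup>2)"
        by (subst nn_integral_square_L2) (auto intro!: L2_diff X ennreal_leI power_mono)
    qed simp
    finally show ?thesis .
  qed
  have diffL2: "(\<lambda>x. X (N 0) x - Y x) \<in> L2 M"
  proof (rule L2_if_nn_integral)
    have "(\<integral>\<^sup>+x. ennreal ((X (N 0) x - Y x)\<^sup>2) \<partial>M) \<le> ennreal (1\<^sup>2)"
      by (rule est[of "N 0"]) (use N[of 0] in auto)
    then show "(\<integral>\<^sup>+x. ennreal ((X (N 0) x - Y x)\<^sup>2) \<partial>M) < \<infinity>"
      by (rule le_less_trans) simp
  qed simp
  have Y: "Y \<in> L2 M"
    using L2_diff[OF X[of "N 0"] diffL2] by simp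
  have "(\<lambda>n. L2_norm M (\<lambda>x. X n x - Y x)) \<longlonglongrightarrow> 0"
  proof (rule LIMSEQ_I)
    fix e :: real assume "0 < e"
    then obtain N0 where N0: "\<And>m n. N0 \<le> m \<Longrightarrow> N0 \<le> n \<Longrightarrow> L2_norm M (\<lambda>x. X m x - X n x) < e/2"
      using Cauchy[of "e/2"] by auto
    have "norm (L2_norm M (\<lambda>x. X n x - Y x) - 0) < e" if "N0 \<le> n" for n
    proof -
      have "ennreal ((L2_norm M (\<lambda>x. X n x - Y x))\<^sup>2) \<le> ennreal ((e/2)\<^sup>2)"
        using est[of N0 n "e/2"] N0 that \<open>0 < e\<close> by (simp add: nn_integral_square_L2[OF L2_diff[OF X Y]])
      then have "(L2_norm M (\<lambda>x. X n x - Y x))\<^sup>2 \<le> (e/2)\<^sup>2"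
        by (subst (asm) ennreal_le_iff) auto
      then have "L2_norm M (\<lambda>x. X n x - Y x) \<le> e/2"
        by (rule power2_le_imp_le) (use \<open>0 < e\<close> in simp)
      then show ?thesis using \<open>0 < e\<close> by simp
    qed
    then show "\<exists>N0. \<forall>n\<ge>N0. norm (L2_norm M (\<lambda>x. X n x - Y x) - 0) < e" by blast
  qed
  with Y show ?thesis by blast
qed

lemma L2_convergent_Cauchy:
  assumes "\<And>n. X n \<in> L2 M" "Y \<in> L2 M" "(\<lambda>n. L2_norm M (\<lambda>x. X n x - Y x)) \<longlonglongrightarrow> 0" "0 < e"
  shows "\<exists>N. \<forall>m\<ge>N. \<forall>n\<ge>N. L2_norm M (\<lambda>x. X m x - X n x) < e"
proof -
  have "0 < e / 2" using assms by simp
  then have "\<forall>\<^sub>F n in sequentially. L2_norm M (\<lambda>x. X n x - Y x) < e / 2"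
    by (rule order_tendstoD(2)[OF assms(3)])
  then obtain N where N: "\<And>n. N \<le> n \<Longrightarrow> L2_norm M (\<lambda>x. X n x - Y x) < e / 2"
    unfolding eventually_sequentially by blast
  have "L2_norm M (\<lambda>x. X m x - X n x) < e" if "N \<le> m" "N \<le> n" for m n
    using L2_norm_triangle_diff[OF assms(1,2,1), of m n] N[OF that(1)] N[OF that(2)]
      L2_norm_minus_commute[of M Y "X n"] by linarith
  then show ?thesis by blast
qed

lemma L2_dominated_convergence:
  assumes X: "\<And>n. X n \<in> borel_measurable M" and Y: "Y \<in> borel_measurable M"
    and b: "b \<in> L2 M" "\<And>n x. x \<in> space M \<Longrightarrow> \<bar>X n x - Y x\<bar> \<le> b x"
    and lim: "\<And>x. x \<in> space M \<Longrightarrow> (\<lambda>n. X n x) \<longlonglongrightarrow> Y x"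
  shows "(\<lambda>n. L2_norm M (\<lambda>x. X n x - Y x)) \<longlonglongrightarrow> 0"
proof -
  note [measurable] = X Y
  have "(\<lambda>n. LINT x|M. (X n x - Y x)\<^sup>2) \<longlonglongrightarrow> (LINT x|M. 0)"
  proof (rule integral_dominated_convergence[where w = "\<lambda>x. (b x)\<^sup>2"])
    show "integrable M (\<lambda>x. (b x)\<^sup>2)"
      by (rule L2_integrable_square[OF b(1)])
    show "AE x in M. (\<lambda>n. (X n x - Y x)\<^sup>2) \<longlonglongrightarrow> 0"
    proof (rule AE_I2)
      fix x assume "x \<in> space M"
      then have "(\<lambda>n. (X n x - Y x)\<^sup>2) \<longlonglongrightarrow> (Y x - Y x)\<^sup>2"
        by (intro tendsto_intros lim)
      then show "(\<lambda>n. (X n x - Y x)\<^sup>2) \<longlonglongrightarrow> 0" by simp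
    qed
    show "AE x in M. norm ((X n x - Y x)\<^sup>2) \<le> (b x)\<^sup>2" for n
    proof (rule AE_I2)
      fix x assume "x \<in> space M"
      then have "\<bar>X n x - Y x\<bar> \<le> \<bar>b x\<bar>"
        using b(2)[of x n] by linarith
      then show "norm ((X n x - Y x)\<^sup>2) \<le> (b x)\<^sup>2"
        by (simp only: abs_le_square_iff real_norm_def abs_power2)
    qed
  qed measurable
  then show ?thesis
    using tendsto_real_sqrt by (fastforce simp: L2_norm_def)
qed

lemma closed_in_L2D:
  fixes X :: "nat \<Rightarrow> 'b \<Rightarrow> real"
  assumes "closed_in_L2 M S" "\<And>n. X n \<in> S" "Y \<in> L2 M"
    "(\<lambda>n. L2_norm M (\<lambda>x. X n x - Y x)) \<longlonglongrightarrow> 0"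
  shows "Y \<in> S"
  using assms unfolding closed_in_L2_def by (metis (no_types))

text \<open>A minimising sequence is Cauchy by the parallelogram law, because the midpoint of two of
  its members lies in \<open>S\<close> and so has squared distance at least \<open>c\<close> from
  \<open>h\<close>. It will be applied to the space of all stochastic integrals against
  \<open>B\<close>.\<close>

lemma L2_projection:
  assumes S: "S \<subseteq> L2 M" "S \<noteq> {}"
    and lin: "\<And>f g a b. f \<in> S \<Longrightarrow> g \<in> S \<Longrightarrow> (\<lambda>x. a * f x + b * g x) \<in> S"
    and closed: "closed_in_L2 M S"
    and h: "h \<in> L2 M"
  shows "\<exists>g\<in>S. \<forall>f\<in>S. (LINT x|M. (h x - g x) * f x) = 0"
proof -
  have L2: "f \<in> L2 M" if "f \<in> S" for f using S that by auto
  define c where "c = (INF g\<in>S. (L2_norm M (\<lambda>x. h x - g x))\<^sup>2)"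
  have bdd: "bdd_below ((\<lambda>g. (L2_norm M (\<lambda>x. h x - g x))\<^sup>2) ` S)"
    by (rule bdd_belowI[of _ 0]) auto
  have c_le: "c \<le> (L2_norm M (\<lambda>x. h x - g x))\<^sup>2" if "g \<in> S" for g
    unfolding c_def by (rule cINF_lower[OF bdd that])
  have "\<exists>g\<in>S. (L2_norm M (\<lambda>x. h x - g x))\<^sup>2 < c + inverse (real (Suc n))" for n
    using cINF_less_iff[OF S(2) bdd, of "c + inverse (real (Suc n))"] by (simp add: c_def)
  then obtain X where X: "\<And>n. X n \<in> S" "\<And>n. (L2_norm M (\<lambda>x. h x - X n x))\<^sup>2 < c + inverse (real (Suc n))"
    by metis
  have hX: "(\<lambda>x. h x - X n x) \<in> L2 M" for n by (intro L2_diff h L2 X)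
  have parallelogram: "(L2_norm M (\<lambda>x. X m x - X n x))\<^sup>2 < 2 * inverse (real (Suc m)) + 2 * inverse (real (Suc n))" for m n
  proof -
    let ?u = "\<lambda>x. h x - X m x" and ?v = "\<lambda>x. h x - X n x"
    have "(L2_norm M (\<lambda>x. ?v x - ?u x))\<^sup>2 + (L2_norm M (\<lambda>x. ?v x + ?u x))\<^sup>2
        = 2 * (L2_norm M ?u)\<^sup>2 + 2 * (L2_norm M ?v)\<^sup>2"
      unfolding L2_norm_add_sq[OF hX hX] L2_norm_diff_sq[OF hX hX] by simp
    moreover have "(\<lambda>x. ?v x - ?u x) = (\<lambda>x. X m x - X n x)"
      by auto
    then have "(L2_norm M (\<lambda>x. ?v x - ?u x))\<^sup>2 = (L2_norm M (\<lambda>x. X m x - X n x))\<^sup>2"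
      by (rule arg_cong)
    moreover have "(L2_norm M (\<lambda>x. ?v x + ?u x))\<^sup>2 = 4 * (L2_norm M (\<lambda>x. h x - (1/2 * X m x + 1/2 * X n x)))\<^sup>2"
    proof -
      have "(\<lambda>x. ?v x + ?u x) = (\<lambda>x. 2 * (h x - (1/2 * X m x + 1/2 * X n x)))"
        by (auto simp: field_simps)
      then show ?thesis by (simp only: L2_norm_scale) (simp add: power_mult_distrib)
    qed
    moreover have "c \<le> (L2_norm M (\<lambda>x. h x - (1/2 * X m x + 1/2 * X n x)))\<^sup>2"
      by (intro c_le lin X)
    ultimately show ?thesis
      using X(2)[of m] X(2)[of n] by linarith
  qed
  have "\<exists>N. \<forall>m\<ge>N. \<forall>n\<ge>N. L2_norm M (\<lambda>x. X m x - X n x) < e" if "0 < e" for e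
  proof -
    have "0 < e\<^sup>2 / 4" using that by simp
    then obtain N where N: "inverse (real (Suc N)) < e\<^sup>2 / 4"
      using reals_Archimedean by blast
    have "L2_norm M (\<lambda>x. X m x - X n x) < e" if "N \<le> m" "N \<le> n" for m n
    proof (rule power_less_imp_less_base)
      have "inverse (real (Suc m)) \<le> inverse (real (Suc N))" "inverse (real (Suc n)) \<le> inverse (real (Suc N))"
        using that by (auto simp: field_simps)
      then show "(L2_norm M (\<lambda>x. X m x - X n x))\<^sup>2 < e\<^sup>2"
        using parallelogram[of m n] N by linarith
    qed (use \<open>0 < e\<close> in simp)
    then show ?thesis by blast
  qed
  then obtain g where g: "g \<in> L2 M" "(\<lambda>n. L2_norm M (\<lambda>x. X n x - g x)) \<longlonglongrightarrow> 0"
    using L2_complete[of X M] L2[OF X(1)] by blast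
  then have gS: "g \<in> S"
    using closed X(1) by (auto simp: closed_in_L2_def)
  have min: "(L2_norm M (\<lambda>x. h x - g x))\<^sup>2 \<le> c"
  proof (rule LIMSEQ_le_const)
    have "(\<lambda>n. (sqrt (c + inverse (real (Suc n))) + L2_norm M (\<lambda>x. X n x - g x))\<^sup>2) \<longlonglongrightarrow> (sqrt (c + 0) + 0)\<^sup>2"
      by (intro tendsto_intros LIMSEQ_inverse_real_of_nat g)
    moreover have "0 \<le> c"
      unfolding c_def using S(2) by (intro cINF_greatest) auto
    ultimately show "(\<lambda>n. (sqrt (c + inverse (real (Suc n))) + L2_norm M (\<lambda>x. X n x - g x))\<^sup>2) \<longlonglongrightarrow> c"
      by simp
    have "(L2_norm M (\<lambda>x. h x - g x))\<^sup>2 \<le> (sqrt (c + inverse (real (Suc n))) + L2_norm M (\<lambda>x. X n x - g x))\<^sup>2" for n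
    proof (rule power_mono)
      have "L2_norm M (\<lambda>x. h x - X n x) \<le> sqrt (c + inverse (real (Suc n)))"
        by (rule real_le_rsqrt) (rule less_imp_le[OF X(2)])
      then show "L2_norm M (\<lambda>x. h x - g x) \<le> sqrt (c + inverse (real (Suc n))) + L2_norm M (\<lambda>x. X n x - g x)"
        using L2_norm_triangle_diff[OF h L2[OF X(1)] g(1), of n] by linarith
    qed simp
    then show "\<exists>N. \<forall>n\<ge>N. (L2_norm M (\<lambda>x. h x - g x))\<^sup>2
        \<le> (sqrt (c + inverse (real (Suc n))) + L2_norm M (\<lambda>x. X n x - g x))\<^sup>2" by blast
  qed
  have "(LINT x|M. (h x - g x) * f x) = 0" if "f \<in> S" for f
  proof -
    \<comment> \<open>\<open>t\<close> is nearly the optimal step p/q along \<open>f\<close>; adding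
      1 avoids a division by zero. Minimality gives \<open>2 * (t * p) \<le> t\<^sup>2 * q\<close>,
      and inserting p = t(q + 1) leaves \<open>t\<^sup>2 * (q + 2) \<le> 0\<close>.\<close>
    define p q t where "p = (LINT x|M. (h x - g x) * f x)" and "q = (L2_norm M f)\<^sup>2" and "t = p / (q + 1)"
    have "(L2_norm M (\<lambda>x. h x - g x))\<^sup>2 \<le> (L2_norm M (\<lambda>x. h x - (1 * g x + t * f x)))\<^sup>2"
      using min c_le[OF lin[OF gS that]] by (rule order_trans)
    also have "(\<lambda>x. h x - (1 * g x + t * f x)) = (\<lambda>x. (h x - g x) - t * f x)" by auto
    also have "(L2_norm M (\<lambda>x. (h x - g x) - t * f x))\<^sup>2
        = (L2_norm M (\<lambda>x. h x - g x))\<^sup>2 + (L2_norm M (\<lambda>x. t * f x))\<^sup>2 - 2 * (LINT x|M. (h x - g x) * (t * f x))"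
      by (rule L2_norm_diff_sq[OF L2_diff[OF h g(1)] L2_scale[OF L2[OF that]]])
    also have "(L2_norm M (\<lambda>x. t * f x))\<^sup>2 = t\<^sup>2 * q"
      by (simp add: L2_norm_scale power_mult_distrib q_def)
    also have "(LINT x|M. (h x - g x) * (t * f x)) = t * p"
      unfolding p_def by (simp add: mult.left_commute)
    finally have *: "2 * (t * p) \<le> t\<^sup>2 * q" by simp
    have q: "0 \<le> q" by (simp add: q_def)
    have p: "p = t * (q + 1)" using q by (simp add: t_def)
    have "t\<^sup>2 * (q + 2) \<le> 0"
      using * unfolding p by (simp add: power2_eq_square algebra_simps)
    then have "t = 0" using q by (auto simp: mult_le_0_iff)
    then show ?thesis using p by (simp add: p_def)
  qed
  with gS show ?thesis by blast
qed

text \<open>A preimage under \<open>f\<close> is one under \<open>g\<close>, up to part of a null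
  set, and the completion contains such sets. This carries measurability back from a predictable
  version to the process itself.\<close>

lemma borel_measurable_completion_AE:
  fixes f g :: "'b \<Rightarrow> real"
  assumes g: "g \<in> borel_measurable M" and eq: "AE x in M. f x = g x"
  shows "f \<in> borel_measurable (completion M)"
proof -
  obtain N where N: "\<And>x. x \<in> space M - N \<Longrightarrow> f x = g x" "N \<in> null_sets M"
    by (rule AE_E3[OF eq]) blast
  show ?thesis
  proof (rule measurableI)
    fix A :: "real set" assume A: "A \<in> sets borel"
    have "f -` A \<inter> space M = (g -` A \<inter> space M - N) \<union> (f -` A \<inter> space M \<inter> N)"
      using N(1) by auto
    moreover have "g -` A \<inter> space M - N \<in> sets M"
      using measurable_sets[OF g A] N(2) by auto
    ultimately have "f -` A \<inter> space M \<in> sets (completion M)"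
      using N(2) by (intro sets_completionI) auto
    then show "f -` A \<inter> space (completion M) \<in> sets (completion M)" by simp
  qed simp
qed

section \<open>Nearest points of closed decomposable sets\<close>

text \<open>No convexity is needed: decomposability makes a minimising sequence \<open>Z\<close> pointwise monotone in
  \<open>\<bar>h - Z n\<bar>\<close>, and keeping only the terms on one side of \<open>h\<close> (a side visited infinitely often) turns
  convergence of \<open>\<bar>h - Z n\<bar>\<close> into convergence of the modified sequence \<open>Y\<close> itself.\<close>

lemma decomposable_closed_nearest:
  fixes S :: "('b \<Rightarrow> real) set"
  assumes S: "S \<subseteq> L2 N" "S \<noteq> {}"
    and decomposable: "\<And>A f g. A \<in> sets N \<Longrightarrow> f \<in> S \<Longrightarrow> g \<in> S \<Longrightarrow> (\<lambda>w. if w \<in> A then f w else g w) \<in> S"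
    and closed: "closed_in_L2 N S"
    and h: "h \<in> L2 N"
  shows "\<exists>g\<in>S. \<forall>g'\<in>S. L2_norm N (\<lambda>w. h w - g w) \<le> L2_norm N (\<lambda>w. h w - g' w)"
proof -
  have L2: "f \<in> L2 N" if "f \<in> S" for f using S that by auto
  note [measurable] = L2_measurable[OF h]
  define c where "c = (INF g\<in>S. L2_norm N (\<lambda>w. h w - g w))"
  have bdd: "bdd_below ((\<lambda>g. L2_norm N (\<lambda>w. h w - g w)) ` S)"
    by (rule bdd_belowI[of _ 0]) auto
  have "\<exists>g\<in>S. L2_norm N (\<lambda>w. h w - g w) < c + inverse (real (Suc n))" for n
    using cINF_less_iff[OF S(2) bdd, of "c + inverse (real (Suc n))"] by (simp add: c_def)
  then obtain X where X: "\<And>n. X n \<in> S" "\<And>n. L2_norm N (\<lambda>w. h w - X n w) < c + inverse (real (Suc n))"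
    by metis
  note [measurable] = L2_measurable[OF L2[OF X(1)]]
  \<comment> \<open>\<open>Z n\<close> is pointwise the closest to \<open>h\<close> among
    \<open>X 0\<close>, ..., \<open>X n\<close>. The comparison is phrased as membership in a set so
    that decomposability applies literally.\<close>
  define Z where "Z = rec_nat (X 0) (\<lambda>n f w. if w \<in> {w \<in> space N. \<bar>h w - X (Suc n) w\<bar> < \<bar>h w - f w\<bar>} then X (Suc n) w else f w)"
  have Z0: "Z 0 = X 0" by (simp add: Z_def)
  have ZSuc: "Z (Suc n) = (\<lambda>w. if w \<in> {w \<in> space N. \<bar>h w - X (Suc n) w\<bar> < \<bar>h w - Z n w\<bar>} then X (Suc n) w else Z n w)" for n
    by (simp only: Z_def nat.rec)
  have ZS: "Z n \<in> S" for n
  proof (induction n)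
    case (Suc n)
    note [measurable] = L2_measurable[OF L2[OF Suc]]
    show ?case unfolding ZSuc
      by (rule decomposable[OF _ X(1) Suc]) measurable
  qed (simp add: Z0 X)
  note [measurable] = L2_measurable[OF L2[OF ZS]]
  define e where "e n w = \<bar>h w - Z n w\<bar>" for n w
  have e_X: "e n w \<le> \<bar>h w - X n w\<bar>" if "w \<in> space N" for n w
    using that by (cases n) (auto simp: e_def Z0 ZSuc)
  have e_dec: "decseq (\<lambda>n. e n w)" if "w \<in> space N" for w
    using that by (auto simp: e_def ZSuc decseq_Suc_iff)
  define l where "l w = lim (\<lambda>n. e n w)" for w
  have e_lim: "(\<lambda>n. e n w) \<longlonglongrightarrow> l w" if "w \<in> space N" for w
  proof -
    have "0 \<le> e n w" for n by (simp add: e_def)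
    with e_dec[OF that] obtain L where "(\<lambda>n. e n w) \<longlonglongrightarrow> L"
      using decseq_convergent by blast
    then show ?thesis
      by (simp add: l_def limI)
  qed
  have l_le: "l w \<le> e n w" if "w \<in> space N" for n w
    using decseq_ge[OF e_dec e_lim] that by blast
  have l_nonneg: "0 \<le> l w" if "w \<in> space N" for w
    using e_lim[OF that] by (rule LIMSEQ_le_const) (auto simp: e_def)
  have [measurable]: "l \<in> borel_measurable N"
    unfolding l_def e_def by measurable
  \<comment> \<open>On \<open>U\<close> the sequence is at or above \<open>h\<close> infinitely
    often; off \<open>U\<close> it is eventually strictly below. \<open>s\<close> records the side,
    and \<open>g\<close> is the point on that side at the limiting distance
    \<open>l\<close>.\<close>
  define U where "U = {w \<in> space N. \<forall>j. \<exists>k\<ge>j. h w \<le> Z k w}"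
  have [measurable]: "U \<in> sets N"
    unfolding U_def by measurable
  define s where "s w = (if w \<in> U then 1 else -1 :: real)" for w
  have [measurable]: "s \<in> borel_measurable N"
    unfolding s_def by measurable
  define g where "g w = h w + s w * l w" for w
  have [measurable]: "g \<in> borel_measurable N"
    unfolding g_def by measurable
  define G where "G n = {w \<in> space N. if w \<in> U then h w \<le> Z n w else Z n w < h w}" for n
  have [measurable]: "G n \<in> sets N" for n
    unfolding G_def by measurable
  have G_freq: "\<exists>k\<ge>j. w \<in> G k" if "w \<in> space N" for w j
  proof (cases "w \<in> U")
    case True
    then show ?thesis using that by (auto simp: G_def U_def)
  next
    case False
    then have "\<exists>i. \<forall>k\<ge>i. Z k w < h w"
      using that unfolding U_def by (simp, metis not_le)
    then obtain i where "\<forall>k\<ge>i. Z k w < h w" ..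
    then show ?thesis using that False by (intro exI[of _ "max i j"]) (auto simp: G_def)
  qed
  have G_eq: "Z n w = h w + s w * e n w" if "w \<in> G n" for n w
    using that by (auto simp: G_def s_def e_def split: if_splits)
  \<comment> \<open>\<open>Y n\<close> is the latest \<open>Z k\<close> with positive
    \<open>k \<le> n\<close> on the chosen side. Until there is one it stays at \<open>Z 0\<close>,
    which may lie on the other side without affecting the limit.\<close>
  define Y where "Y = rec_nat (Z 0) (\<lambda>n f w. if w \<in> G (Suc n) then Z (Suc n) w else f w)"
  have Y0: "Y 0 = Z 0" by (simp add: Y_def)
  have YSuc: "Y (Suc n) = (\<lambda>w. if w \<in> G (Suc n) then Z (Suc n) w else Y n w)" for n
    by (simp only: Y_def nat.rec)
  have YS: "Y n \<in> S" for n
  proof (induction n)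
    case (Suc n)
    show ?case unfolding YSuc
      by (rule decomposable[OF _ ZS Suc]) measurable
  qed (simp add: Y0 ZS)
  note [measurable] = L2_measurable[OF L2[OF YS]]
  have Y_bound: "\<bar>h w - Y n w\<bar> \<le> e 0 w" if "w \<in> space N" for n w
  proof (induction n)
    case 0
    then show ?case by (simp add: Y0 e_def)
  next
    case (Suc n)
    have "\<bar>h w - Z (Suc n) w\<bar> \<le> e 0 w"
      using decseqD[OF e_dec[OF that], of 0 "Suc n"] by (simp add: e_def)
    then show ?case using Suc by (simp add: YSuc)
  qed
  have Y_lim: "(\<lambda>n. Y n w) \<longlonglongrightarrow> g w" if w: "w \<in> space N" for w
  proof (rule LIMSEQ_I)
    fix r :: real assume "0 < r"
    then obtain j where j: "\<And>k. j \<le> k \<Longrightarrow> \<bar>e k w - l w\<bar> < r"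
      using LIMSEQ_D[OF e_lim[OF w]] by (metis real_norm_def)
    \<comment> \<open>Asking for \<open>Suc j\<close> makes \<open>k0\<close> a successor, so that
      the recursion equation of \<open>Y\<close> applies at \<open>k0\<close>.\<close>
    obtain k0 where k0: "Suc j \<le> k0" "w \<in> G k0"
      using G_freq[OF w] by blast
    have "\<exists>k\<ge>j. Y n w = Z k w \<and> w \<in> G k" if "k0 \<le> n" for n
      using that
    proof (induction n rule: dec_induct)
      case base
      obtain i where "k0 = Suc i" using k0 by (cases k0) auto
      then show ?case using k0 by (intro exI[of _ k0]) (auto simp: YSuc)
    next
      case (step n)
      then show ?case
        using k0 by (cases "w \<in> G (Suc n)") (auto simp: YSuc intro: exI[of _ "Suc n"])
    qed
    then have "norm (Y n w - g w) < r" if "k0 \<le> n" for n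
      using that j G_eq by (fastforce simp: g_def s_def split: if_splits)
    then show "\<exists>no. \<forall>n\<ge>no. norm (Y n w - g w) < r" by blast
  qed
  have g_h: "\<bar>h w - g w\<bar> = l w" if "w \<in> space N" for w
    using l_nonneg[OF that] by (simp add: g_def s_def)
  have e0: "e 0 \<in> L2 N"
    unfolding e_def by (intro L2_abs L2_diff h L2 ZS)
  have hgL2: "(\<lambda>w. h w - g w) \<in> L2 N"
    by (rule L2_bounded_by[OF e0]) (use g_h l_le in \<open>fastforce simp: e_def\<close>)+
  have gL2: "g \<in> L2 N"
    using L2_diff[OF h hgL2] by simp
  have "(\<lambda>n. L2_norm N (\<lambda>w. Y n w - g w)) \<longlonglongrightarrow> 0"
  proof (rule L2_dominated_convergence[OF _ _ L2_scale[OF e0, of 2] _ Y_lim])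
    \<comment> \<open>Both \<open>Y n\<close> and \<open>g\<close> lie within \<open>e 0\<close> of
      \<open>h\<close>, hence the factor 2.\<close>
    show "\<bar>Y n w - g w\<bar> \<le> 2 * e 0 w" if w: "w \<in> space N" for n w
      using Y_bound[OF w, of n] g_h[OF w] l_le[OF w, of 0] by linarith
  qed measurable
  then have gS: "g \<in> S"
    by (rule closed_in_L2D[where X = Y, OF closed YS gL2])
  have "L2_norm N (\<lambda>w. h w - g w) \<le> c + inverse (real (Suc n))" for n
  proof -
    have "L2_norm N (\<lambda>w. h w - g w) \<le> L2_norm N (\<lambda>w. h w - X n w)"
      by (rule L2_norm_mono[OF hgL2 L2_diff[OF h L2[OF X(1)]]], rule AE_I2)
        (use g_h l_le[of _ n] e_X[of _ n] in \<open>fastforce intro: order_trans\<close>)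
    then show ?thesis using X(2)[of n] by simp
  qed
  moreover have "(\<lambda>n. c + inverse (real (Suc n))) \<longlonglongrightarrow> c + 0"
    by (intro tendsto_intros LIMSEQ_inverse_real_of_nat)
  ultimately have "L2_norm N (\<lambda>w. h w - g w) \<le> c"
    using LIMSEQ_le_const[of "\<lambda>n. c + inverse (real (Suc n))" "c + 0"] by auto
  then show ?thesis
    using gS cINF_lower[OF bdd] unfolding c_def by (intro bexI[of _ g] ballI) (rule order_trans)
qed

section \<open>Parametrised families that are smooth in the parameter\<close>

lemma borel_measurable_caratheodory:
  fixes f :: "real \<Rightarrow> 'b \<Rightarrow> real"
  assumes meas: "\<And>x. f x \<in> borel_measurable N"
    and cont: "\<And>w. w \<in> space N \<Longrightarrow> continuous_on UNIV (\<lambda>x. f x w)"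
    and \<theta>: "\<theta> \<in> borel_measurable N"
  shows "(\<lambda>w. f (\<theta> w) w) \<in> borel_measurable N"
proof (rule borel_measurable_LIMSEQ_real)
  \<comment> \<open>Rounding \<open>\<theta>\<close> down to a grid of mesh 1/(n+1) leaves countably
    many values, for which measurability of each single \<open>f x\<close> suffices. Continuity in
    the parameter then gives the limit.\<close>
  define q where "q n w = real_of_int \<lfloor>\<theta> w * real (Suc n)\<rfloor> / real (Suc n)" for n w
  show "(\<lambda>w. f (q n w) w) \<in> borel_measurable N" for n
    unfolding q_def
    by (rule measurable_compose_countable[where f = "\<lambda>i w. f (real_of_int i / real (Suc n)) w"])
      (use meas \<theta> in measurable)
  show "(\<lambda>n. f (q n w) w) \<longlonglongrightarrow> f (\<theta> w) w" if w: "w \<in> space N" for w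
  proof (rule continuous_on_tendsto_compose[OF cont[OF w]])
    show "(\<lambda>n. q n w) \<longlonglongrightarrow> \<theta> w"
    proof (rule LIMSEQ_I)
      fix r :: real assume "0 < r"
      then obtain n0 where n0: "inverse (real (Suc n0)) < r" using reals_Archimedean by blast
      have "norm (q n w - \<theta> w) < r" if "n0 \<le> n" for n
      proof -
        have "q n w - \<theta> w = (real_of_int \<lfloor>\<theta> w * real (Suc n)\<rfloor> - \<theta> w * real (Suc n)) / real (Suc n)"
          by (simp add: q_def diff_divide_distrib del: of_nat_Suc)
        then have "\<bar>q n w - \<theta> w\<bar> = \<bar>real_of_int \<lfloor>\<theta> w * real (Suc n)\<rfloor> - \<theta> w * real (Suc n)\<bar> / real (Suc n)"
          by (simp add: abs_divide del: of_nat_Suc)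
        also have "\<dots> \<le> 1 / real (Suc n)"
          by (intro divide_right_mono) linarith+
        also have "\<dots> \<le> inverse (real (Suc n0))"
          using that by (simp add: field_simps)
        finally show ?thesis using n0 by simp
      qed
      then show "\<exists>no. \<forall>n\<ge>no. norm (q n w - \<theta> w) < r" by blast
    qed
  qed auto
qed

text \<open>A point \<open>w\<close> stands for a pair (t, omega), \<open>N\<close> for the Doleans
  measure, \<open>m\<close> for the integrands and \<open>d\<close> for their derivative in the
  parameter. Smoothness is demanded at every point of the space, so exceptional points have to be
  removed before this is instantiated.\<close>

locale smooth_family = finite_measure N for N :: "'b measure" +
  fixes m d :: "real \<Rightarrow> 'b \<Rightarrow> real"
  assumes m_measurable: "\<And>x. m x \<in> borel_measurable N"
    and m_deriv: "\<And>w x. w \<in> space N \<Longrightarrow> ((\<lambda>y. m y w) has_real_derivative d x w) (at x)"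
    and d_cont: "\<And>w. w \<in> space N \<Longrightarrow> continuous_on UNIV (\<lambda>x. d x w)"
begin

lemma m_cont: "w \<in> space N \<Longrightarrow> continuous_on UNIV (\<lambda>x. m x w)"
  using m_deriv by (meson DERIV_continuous_on has_field_derivative_at_within)

lemma d_measurable: "d x \<in> borel_measurable N"
proof (rule borel_measurable_LIMSEQ_real)
  let ?u = "\<lambda>n w. (m (x + inverse (real (Suc n))) w - m x w) / inverse (real (Suc n))"
  show "?u n \<in> borel_measurable N" for n
    using m_measurable by measurable
  show "(\<lambda>n. ?u n w) \<longlonglongrightarrow> d x w" if "w \<in> space N" for w
  proof -
    have "((\<lambda>t. (m (x + t) w - m x w) / t) \<longlongrightarrow> d x w) (at 0)"
      using m_deriv[OF that, of x] by (simp add: DERIV_def)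
    moreover have "filterlim (\<lambda>n. inverse (real (Suc n))) (at 0) sequentially"
      unfolding filterlim_at using LIMSEQ_inverse_real_of_nat by auto
    ultimately show ?thesis by (rule filterlim_compose)
  qed
qed

lemma m_comp_measurable: "\<theta> \<in> borel_measurable N \<Longrightarrow> (\<lambda>w. m (\<theta> w) w) \<in> borel_measurable N"
  by (rule borel_measurable_caratheodory[OF m_measurable m_cont])

lemma d_comp_measurable: "\<theta> \<in> borel_measurable N \<Longrightarrow> (\<lambda>w. d (\<theta> w) w) \<in> borel_measurable N"
  by (rule borel_measurable_caratheodory[OF d_measurable d_cont])

definition adm :: "('b \<Rightarrow> real) set" where
  "adm = {\<theta> \<in> borel_measurable N. (\<lambda>w. m (\<theta> w) w) \<in> L2 N \<and> (\<lambda>w. d (\<theta> w) w) \<in> L2 N}"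

text \<open>The counterpart of \<open>nl_range\<close> among integrands. It is saturated under
  almost everywhere equality because L2 limits are determined only up to null sets.\<close>

definition rng :: "('b \<Rightarrow> real) set" where
  "rng = {g \<in> L2 N. \<exists>\<theta>\<in>adm. AE w in N. g w = m (\<theta> w) w}"

text \<open>\<open>\<theta>\<^sub>1\<close> is controlled on \<open>A\<close> only, so it need not
  be admissible. For gluing, the bounds come from a second admissible parameter; for the variational
  argument, they are constants.\<close>

lemma adm_if:
  assumes "A \<in> sets N" "\<theta>\<^sub>1 \<in> borel_measurable N" "\<theta>\<^sub>2 \<in> adm"
    and b: "b \<in> L2 N" "\<And>w. w \<in> A \<Longrightarrow> \<bar>m (\<theta>\<^sub>1 w) w\<bar> \<le> \<bar>b w\<bar>"
    and b': "b' \<in> L2 N" "\<And>w. w \<in> A \<Longrightarrow> \<bar>d (\<theta>\<^sub>1 w) w\<bar> \<le> \<bar>b' w\<bar>"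
  shows "(\<lambda>w. if w \<in> A then \<theta>\<^sub>1 w else \<theta>\<^sub>2 w) \<in> adm"
proof -
  let ?\<theta> = "\<lambda>w. if w \<in> A then \<theta>\<^sub>1 w else \<theta>\<^sub>2 w"
  have \<theta>2: "\<theta>\<^sub>2 \<in> borel_measurable N" "(\<lambda>w. m (\<theta>\<^sub>2 w) w) \<in> L2 N" "(\<lambda>w. d (\<theta>\<^sub>2 w) w) \<in> L2 N"
    using assms(3) by (auto simp: adm_def)
  have \<theta>: "?\<theta> \<in> borel_measurable N"
    using assms(1,2) \<theta>2(1) by measurable
  have "(\<lambda>w. m (?\<theta> w) w) \<in> L2 N"
    by (rule L2_bounded_by[OF L2_add[OF L2_abs[OF b(1)] L2_abs[OF \<theta>2(2)]] m_comp_measurable[OF \<theta>]])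
      (use b(2) in \<open>fastforce intro!: AE_I2\<close>)
  moreover have "(\<lambda>w. d (?\<theta> w) w) \<in> L2 N"
    by (rule L2_bounded_by[OF L2_add[OF L2_abs[OF b'(1)] L2_abs[OF \<theta>2(3)]] d_comp_measurable[OF \<theta>]])
      (use b'(2) in \<open>fastforce intro!: AE_I2\<close>)
  ultimately show ?thesis using \<theta> by (simp add: adm_def)
qed

lemma rng_decomposable:
  assumes "A \<in> sets N" "f \<in> rng" "g \<in> rng"
  shows "(\<lambda>w. if w \<in> A then f w else g w) \<in> rng"
proof -
  obtain \<theta>\<^sub>1 \<theta>\<^sub>2 where \<theta>: "\<theta>\<^sub>1 \<in> adm" "AE w in N. f w = m (\<theta>\<^sub>1 w) w" "\<theta>\<^sub>2 \<in> adm" "AE w in N. g w = m (\<theta>\<^sub>2 w) w"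
    using assms by (auto simp: rng_def)
  have "(\<lambda>w. if w \<in> A then \<theta>\<^sub>1 w else \<theta>\<^sub>2 w) \<in> adm"
    by (rule adm_if[OF assms(1) _ \<theta>(3), of _ "\<lambda>w. m (\<theta>\<^sub>1 w) w" "\<lambda>w. d (\<theta>\<^sub>1 w) w"])
      (use \<theta>(1) in \<open>auto simp: adm_def\<close>)
  moreover have "AE w in N. (if w \<in> A then f w else g w)
      = m (if w \<in> A then \<theta>\<^sub>1 w else \<theta>\<^sub>2 w) w"
    using \<theta>(2,4) by eventually_elim auto
  moreover have "(\<lambda>w. if w \<in> A then f w else g w) \<in> L2 N"
  proof (rule L2_bounded_by[OF L2_add[OF L2_abs L2_abs]])
    show "f \<in> L2 N" "g \<in> L2 N" using assms by (auto simp: rng_def)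
    then show "(\<lambda>w. if w \<in> A then f w else g w) \<in> borel_measurable N"
      using assms(1) by measurable
  qed auto
  ultimately show ?thesis
    unfolding rng_def by (intro CollectI conjI bexI)
qed

text \<open>If \<open>(h - m \<theta>) d \<theta>\<close> were nonzero at \<open>w\<close>, a step of size \<open>1/(n+1)\<close> in one of the two directions
  would be an improvement at \<open>w\<close> for large \<open>n\<close>. Doing it only on the set \<open>A\<close> where it improves and
  where the new values are bounded by \<open>n\<close> keeps the competitor admissible, so \<open>A\<close> is null; no
  differentiation under the integral sign is involved.\<close>

lemma nearest_stationary:
  assumes \<theta>: "\<theta> \<in> adm" and h: "h \<in> L2 N"
    and min: "\<And>\<theta>'. \<theta>' \<in> adm \<Longrightarrow>
      L2_norm N (\<lambda>w. h w - m (\<theta> w) w) \<le> L2_norm N (\<lambda>w. h w - m (\<theta>' w) w)"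
  shows "AE w in N. (h w - m (\<theta> w) w) * d (\<theta> w) w = 0"
proof -
  have \<theta>m: "\<theta> \<in> borel_measurable N" and \<theta>L: "(\<lambda>w. m (\<theta> w) w) \<in> L2 N"
    using \<theta> by (auto simp: adm_def)
  note [measurable] = L2_measurable[OF h]
  define p where "p \<sigma> n w = \<theta> w + \<sigma> * inverse (real (Suc n))" for \<sigma> n w
  have [measurable]: "p \<sigma> n \<in> borel_measurable N" for \<sigma> n
    unfolding p_def using \<theta>m by measurable
  note [measurable] = \<theta>m m_comp_measurable d_comp_measurable
  define A where "A \<sigma> n = {w \<in> space N. \<bar>h w - m (p \<sigma> n w) w\<bar> < \<bar>h w - m (\<theta> w) w\<bar> \<and>
      \<bar>m (p \<sigma> n w) w\<bar> \<le> real n \<and> \<bar>d (p \<sigma> n w) w\<bar> \<le> real n}" for \<sigma> n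
  have A [measurable]: "A \<sigma> n \<in> sets N" for \<sigma> n
    unfolding A_def by measurable
  have null: "AE w in N. w \<notin> A \<sigma> n" for \<sigma> n
  proof -
    let ?\<theta> = "\<lambda>w. if w \<in> A \<sigma> n then p \<sigma> n w else \<theta> w"
    have adm': "?\<theta> \<in> adm"
      by (rule adm_if[OF A _ \<theta>, where b = "\<lambda>_. real n" and b' = "\<lambda>_. real n"])
        (auto simp: A_def L2_def)
    then have L': "(\<lambda>w. m (?\<theta> w) w) \<in> L2 N" by (simp add: adm_def)
    have le: "(h w - m (?\<theta> w) w)\<^sup>2 \<le> (h w - m (\<theta> w) w)\<^sup>2" for w
      by (auto simp: A_def abs_le_square_iff[symmetric])
    have i1: "integrable N (\<lambda>w. (h w - m (\<theta> w) w)\<^sup>2)"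
      by (intro L2_integrable_square L2_diff h \<theta>L)
    have i2: "integrable N (\<lambda>w. (h w - m (?\<theta> w) w)\<^sup>2)"
      by (intro L2_integrable_square L2_diff h L')
    \<comment> \<open>The modified parameter is nowhere worse, and minimality says that it is not
      better on average. So the nonnegative gain integrates to 0, whereas it is strictly positive on
      \<open>A \<sigma> n\<close>.\<close>
    have "(LINT w|N. (h w - m (\<theta> w) w)\<^sup>2) \<le> (LINT w|N. (h w - m (?\<theta> w) w)\<^sup>2)"
      using min[OF adm'] by (simp add: L2_norm_def)
    moreover have "(LINT w|N. (h w - m (?\<theta> w) w)\<^sup>2) \<le> (LINT w|N. (h w - m (\<theta> w) w)\<^sup>2)"
      by (rule integral_mono[OF i2 i1 le])
    ultimately have "(LINT w|N. (h w - m (\<theta> w) w)\<^sup>2 - (h w - m (?\<theta> w) w)\<^sup>2) = 0"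
      using i1 i2 by simp
    then have "AE w in N. (h w - m (\<theta> w) w)\<^sup>2 - (h w - m (?\<theta> w) w)\<^sup>2 = 0"
      by (subst (asm) integral_nonneg_eq_0_iff_AE) (use i1 i2 le in auto)
    then show ?thesis
    proof eventually_elim
      case (elim w)
      show ?case
      proof
        assume w: "w \<in> A \<sigma> n"
        then have "\<bar>h w - m (p \<sigma> n w) w\<bar> < \<bar>h w - m (\<theta> w) w\<bar>" by (simp add: A_def)
        then have "(h w - m (p \<sigma> n w) w)\<^sup>2 < (h w - m (\<theta> w) w)\<^sup>2"
          by (metis abs_le_square_iff not_le)
        then show False using elim w by simp
      qed
    qed
  qed
  have "AE w in N. \<forall>n. w \<notin> A 1 n \<and> w \<notin> A (-1) n"
    by (intro AE_all_countable[THEN iffD2] allI AE_conjI null)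
  then show ?thesis
  proof (rule AE_mp, intro AE_I2 impI)
    fix w assume w: "w \<in> space N" and nA: "\<forall>n. w \<notin> A 1 n \<and> w \<notin> A (-1) n"
    show "(h w - m (\<theta> w) w) * d (\<theta> w) w = 0"
    proof (rule ccontr)
      assume nz: "(h w - m (\<theta> w) w) * d (\<theta> w) w \<noteq> 0"
      \<comment> \<open>This direction moves \<open>m\<close> towards \<open>h\<close>: the
        derivative of \<open>\<phi>\<close> at 0 becomes minus twice the absolute value of the
        product.\<close>
      define \<sigma> where "\<sigma> = sgn ((h w - m (\<theta> w) w) * d (\<theta> w) w)"
      have \<sigma>: "\<sigma> = 1 \<or> \<sigma> = -1" using nz by (auto simp: \<sigma>_def sgn_if)
      define \<phi> where "\<phi> t = (h w - m (\<theta> w + \<sigma> * t) w)\<^sup>2" for t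
      have dm: "((\<lambda>t. m (\<theta> w + \<sigma> * t) w) has_real_derivative (d (\<theta> w) w * \<sigma>)) (at 0)"
        by (rule DERIV_chain2[where g = "\<lambda>t. \<theta> w + \<sigma> * t" and f = "\<lambda>y. m y w"])
          (use m_deriv[OF w, of "\<theta> w"] in \<open>auto intro!: derivative_eq_intros\<close>)
      have "(\<phi> has_real_derivative (2 * (h w - m (\<theta> w) w) * (- (d (\<theta> w) w * \<sigma>)))) (at 0)"
        unfolding \<phi>_def by (rule derivative_eq_intros dm refl)+ simp
      moreover have "2 * (h w - m (\<theta> w) w) * (- (d (\<theta> w) w * \<sigma>)) < 0"
      proof -
        have "0 < (h w - m (\<theta> w) w) * d (\<theta> w) w * \<sigma>"
          using nz unfolding \<sigma>_def by (metis abs_sgn zero_less_abs_iff)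
        then show ?thesis by (simp add: algebra_simps)
      qed
      ultimately obtain r where r: "0 < r" "\<And>t. 0 < t \<Longrightarrow> t < r \<Longrightarrow> \<phi> (0 + t) < \<phi> 0"
        using DERIV_neg_dec_right[of \<phi> _ 0] by blast
      have inv0: "(\<lambda>n. inverse (real (Suc n))) \<longlonglongrightarrow> 0"
        by (rule LIMSEQ_inverse_real_of_nat)
      have p_lim: "(\<lambda>n. p \<sigma> n w) \<longlonglongrightarrow> \<theta> w"
        unfolding p_def using tendsto_add[OF tendsto_const tendsto_mult[OF tendsto_const inv0], of "\<theta> w" \<sigma>] by simp
      \<comment> \<open>The values of \<open>m\<close> and \<open>d\<close> at the shifted points
        converge, so they are eventually below a fixed bound, and the threshold \<open>n\<close> in
        \<open>A \<sigma> n\<close> overtakes it.\<close>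
      have "(\<lambda>n. \<bar>m (p \<sigma> n w) w\<bar>) \<longlonglongrightarrow> \<bar>m (\<theta> w) w\<bar>"
        by (intro tendsto_rabs continuous_on_tendsto_compose[OF m_cont[OF w] p_lim]) auto
      then have "\<forall>\<^sub>F n in sequentially. \<bar>m (p \<sigma> n w) w\<bar> < \<bar>m (\<theta> w) w\<bar> + 1"
        by (rule order_tendstoD) simp
      moreover have "(\<lambda>n. \<bar>d (p \<sigma> n w) w\<bar>) \<longlonglongrightarrow> \<bar>d (\<theta> w) w\<bar>"
        by (intro tendsto_rabs continuous_on_tendsto_compose[OF d_cont[OF w] p_lim]) auto
      then have "\<forall>\<^sub>F n in sequentially. \<bar>d (p \<sigma> n w) w\<bar> < \<bar>d (\<theta> w) w\<bar> + 1"
        by (rule order_tendstoD) simp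
      moreover have "\<forall>\<^sub>F n in sequentially. \<bar>m (\<theta> w) w\<bar> + 1 \<le> real n"
        using filterlim_real_sequentially by (simp add: filterlim_at_top)
      moreover have "\<forall>\<^sub>F n in sequentially. \<bar>d (\<theta> w) w\<bar> + 1 \<le> real n"
        using filterlim_real_sequentially by (simp add: filterlim_at_top)
      moreover have "\<forall>\<^sub>F n in sequentially. inverse (real (Suc n)) < r"
        using inv0 r(1) by (rule order_tendstoD)
      ultimately have "\<forall>\<^sub>F n in sequentially. w \<in> A \<sigma> n"
      proof eventually_elim
        case (elim n)
        have "\<phi> (inverse (real (Suc n))) < \<phi> 0"
          using r(2)[of "inverse (real (Suc n))"] elim(5) by simp
        then have "\<bar>h w - m (p \<sigma> n w) w\<bar> < \<bar>h w - m (\<theta> w) w\<bar>"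
          unfolding \<phi>_def p_def by (metis abs_le_square_iff not_le add.right_neutral mult_zero_right)
        then show ?case using elim w by (simp add: A_def)
      qed
      then obtain n where "w \<in> A \<sigma> n"
        using eventually_happens'[OF sequentially_bot] by blast
      then show False using nA \<sigma> by auto
    qed
  qed
qed

lemma nearest_exists:
  assumes h: "h \<in> L2 N" and ne: "adm \<noteq> {}" and closed: "closed_in_L2 N rng"
  shows "\<exists>\<theta>\<in>adm. (AE w in N. (h w - m (\<theta> w) w) * d (\<theta> w) w = 0) \<and>
    (\<forall>\<theta>'\<in>adm. L2_norm N (\<lambda>w. h w - m (\<theta> w) w) \<le> L2_norm N (\<lambda>w. h w - m (\<theta>' w) w))"
proof -
  have adm_rng: "(\<lambda>w. m (\<theta> w) w) \<in> rng" if "\<theta> \<in> adm" for \<theta>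
    using that by (auto simp: rng_def adm_def)
  have "\<exists>g\<in>rng. \<forall>g'\<in>rng. L2_norm N (\<lambda>w. h w - g w) \<le> L2_norm N (\<lambda>w. h w - g' w)"
    by (rule decomposable_closed_nearest[OF _ _ rng_decomposable closed h])
      (use ne adm_rng in \<open>auto simp: rng_def\<close>)
  then obtain g where g: "g \<in> rng" "\<And>g'. g' \<in> rng \<Longrightarrow> L2_norm N (\<lambda>w. h w - g w) \<le> L2_norm N (\<lambda>w. h w - g' w)"
    by blast
  then obtain \<theta> where \<theta>: "\<theta> \<in> adm" "AE w in N. g w = m (\<theta> w) w"
    by (auto simp: rng_def)
  have "L2_norm N (\<lambda>w. h w - g w) = L2_norm N (\<lambda>w. h w - m (\<theta> w) w)"
    by (rule L2_norm_cong_AE)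
      (use h g(1) \<theta> in \<open>auto simp: rng_def adm_def intro: L2_measurable L2_diff\<close>)
  then have min: "L2_norm N (\<lambda>w. h w - m (\<theta> w) w) \<le> L2_norm N (\<lambda>w. h w - m (\<theta>' w) w)" if "\<theta>' \<in> adm" for \<theta>'
    using g(2)[OF adm_rng[OF that]] by simp
  have "AE w in N. (h w - m (\<theta> w) w) * d (\<theta> w) w = 0"
    using min by (rule nearest_stationary[OF \<theta>(1) h])
  with \<theta>(1) min show ?thesis by (intro bexI[of _ \<theta>] conjI ballI)
qed

end

section \<open>The Ito isometry\<close>

context filtered_prob_space begin

lemma F_space: "0 \<le> t \<Longrightarrow> space (F t) = space P"
  using filtration.space_F[OF filtration, of "ennreal t"] by (simp add: extended_filtration_def)

lemma F_mono: "0 \<le> s \<Longrightarrow> s \<le> t \<Longrightarrow> sets (F s) \<subseteq> sets (F t)"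
  using filtration.sets_F_mono[OF filtration, of "ennreal s" "ennreal t"]
  by (simp add: extended_filtration_def)

lemma F_subset: "0 \<le> t \<Longrightarrow> sets (F t) \<subseteq> sets P"
  using filtration.sets_F_mono[OF filtration, of "ennreal t" \<infinity>]
  by (simp add: extended_filtration_def)

lemma F_subalgebra: "0 \<le> t \<Longrightarrow> subalgebra P (F t)"
  by (simp add: subalgebra_def F_space F_subset)

lemma F_borel_mono:
  assumes "f \<in> borel_measurable (F s)" "0 \<le> s" "s \<le> t"
  shows "f \<in> borel_measurable (F t)"
  by (rule measurable_from_subalg[OF _ assms(1)]) (use assms in \<open>auto simp: subalgebra_def F_space dest: F_mono\<close>)

lemma F_borel: "f \<in> borel_measurable (F s) \<Longrightarrow> 0 \<le> s \<Longrightarrow> f \<in> borel_measurable P"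
  by (rule measurable_from_subalg[OF F_subalgebra])

section \<open>Predictable rectangles\<close>

definition rectangles :: "(real \<times> 'a) set set" where
  "rectangles = {{0} \<times> A |A. A \<in> sets (F 0)} \<union>
     {{s<..t} \<times> A |s t A. 0 \<le> s \<and> s \<le> t \<and> A \<in> sets (F s)}"

lemma rectangles_Pow: "rectangles \<subseteq> Pow ({0..} \<times> space P)"
  by (auto simp: rectangles_def F_space dest!: sets.sets_into_space)

lemma rectanglesE:
  assumes "a \<in> rectangles"
  obtains (initial) A where "a = {0} \<times> A" "A \<in> sets (F 0)"
    | (interval) s t A where "a = {s<..t} \<times> A" "0 \<le> s" "s \<le> t" "A \<in> sets (F s)"
  using assms unfolding rectangles_def by blast

lemma sets_predictable: "sets (predictable_sigma P F) = sigma_sets ({0..} \<times> space P) rectangles"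
  using rectangles_Pow by (simp add: predictable_sigma_def rectangles_def)

text \<open>Being a pi-system is used twice: for uniqueness of the Doleans measure and for the
  Dynkin induction over integrable indicators. Two strips meet in one starting at the later of the
  two left ends, where both events are already known.\<close>

lemma rectangles_Int_stable: "Int_stable rectangles"
proof (rule Int_stableI)
  fix a b assume ab: "a \<in> rectangles" "b \<in> rectangles"
  have empty: "{} \<in> rectangles"
    unfolding rectangles_def by (rule UnI1) (auto intro!: exI[of _ "{}"])
  have *: "({s<..t} \<times> A) \<inter> ({s'<..t'} \<times> A') \<in> rectangles"
    if "0 \<le> s" "0 \<le> s'" "A \<in> sets (F s)" "A' \<in> sets (F s')" for s t s' t' A A'
  proof (cases "max s s' \<le> min t t'")
    case True
    have "({s<..t} \<times> A) \<inter> ({s'<..t'} \<times> A') = {max s s'<..min t t'} \<times> (A \<inter> A')"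
      by auto
    moreover have "A \<inter> A' \<in> sets (F (max s s'))"
      using that F_mono[of s "max s s'"] F_mono[of s' "max s s'"] by auto
    moreover have "0 \<le> max s s'" using that by auto
    ultimately show ?thesis
      using True unfolding rectangles_def by blast
  next
    case False
    then have "({s<..t} \<times> A) \<inter> ({s'<..t'} \<times> A') = {}" by auto
    then show ?thesis using empty by simp
  qed
  from ab(1) show "a \<inter> b \<in> rectangles"
  proof (cases rule: rectanglesE)
    case (initial A)
    from ab(2) show ?thesis
    proof (cases rule: rectanglesE)
      case initial': (initial A')
      have "a \<inter> b = {0} \<times> (A \<inter> A')" using initial(1) initial'(1) by auto
      then show ?thesis
        using initial(2) initial'(2) unfolding rectangles_def by blast
    next
      case (interval s t A')
      have "a \<inter> b = {}" using initial(1) interval(1,2) by auto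
      then show ?thesis using empty by simp
    qed
  next
    case (interval s t A)
    from ab(2) show ?thesis
    proof (cases rule: rectanglesE)
      case (initial A')
      have "a \<inter> b = {}" using initial(1) interval(1,2) by auto
      then show ?thesis using empty by simp
    next
      case interval': (interval s' t' A')
      then show ?thesis using interval * by simp
    qed
  qed
qed

end

section \<open>The Doleans measure\<close>

locale ito_integrator = filtered_prob_space P F for P :: "'a measure" and F +
  fixes B :: "real \<Rightarrow> 'a \<Rightarrow> real" and \<nu> :: "(real \<times> 'a) measure"
  assumes B: "B \<in> M2_0 P F" and doleans: "doleans_measure P F B \<nu>"
begin

lemma B_F: "0 \<le> t \<Longrightarrow> B t \<in> borel_measurable (F t)"
  and B_0: "AE \<omega> in P. B 0 \<omega> = 0"
  and B_cond_exp: "0 \<le> s \<Longrightarrow> s \<le> t \<Longrightarrow> AE \<omega> in P. real_cond_exp P (F s) (B t) \<omega> = B s \<omega>"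
  using B by (auto simp: M2_0_def M2_def martingale_def)

lemma B_borel: "0 \<le> t \<Longrightarrow> B t \<in> borel_measurable P"
  using B_F F_borel by blast

definition energy :: ennreal where
  "energy = (\<integral>\<^sup>+\<omega>. (SUP t\<in>{0..}. ennreal ((B t \<omega>)\<^sup>2)) \<partial>P)"

lemma energy_finite: "energy < \<infinity>"
  using B by (simp add: M2_0_def M2_def energy_def)

lemma B_energy: "0 \<le> t \<Longrightarrow> (\<integral>\<^sup>+\<omega>. ennreal ((B t \<omega>)\<^sup>2) \<partial>P) \<le> energy"
  unfolding energy_def by (intro nn_integral_mono SUP_upper) simp

lemma B_L2: "0 \<le> t \<Longrightarrow> B t \<in> L2 P"
  by (intro L2_if_nn_integral B_borel le_less_trans[OF B_energy energy_finite])

text \<open>\<open>Z\<close> need not be bounded, so it may itself contain earlier increments of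
  \<open>B\<close>. It can be pulled out of the conditional expectation because a product of two L2
  functions is integrable.\<close>

lemma increment_orthogonal:
  assumes "0 \<le> s" "s \<le> t" "Z \<in> borel_measurable (F s)" "Z \<in> L2 P"
  shows "(LINT \<omega>|P. Z \<omega> * (B t \<omega> - B s \<omega>)) = 0"
proof -
  interpret finite_measure_subalgebra P "F s"
    by standard (use assms F_subalgebra in auto)
  have "(LINT \<omega>|P. Z \<omega> * B t \<omega>) = (LINT \<omega>|P. Z \<omega> * real_cond_exp P (F s) (B t) \<omega>)"
    using assms by (intro real_cond_exp_intg(2)[symmetric] L2_mult_integrable B_L2 B_borel) auto
  also have "\<dots> = (LINT \<omega>|P. Z \<omega> * B s \<omega>)"
  proof (rule integral_cong_AE)
    show "AE \<omega> in P. Z \<omega> * real_cond_exp P (F s) (B t) \<omega> = Z \<omega> * B s \<omega>"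
      using B_cond_exp[OF assms(1,2)] by eventually_elim simp
  qed (use assms B_borel in \<open>auto intro!: borel_measurable_times dest: L2_measurable\<close>)
  finally show ?thesis
    using assms by (simp add: right_diff_distrib L2_mult_integrable B_L2)
qed

lemma sets_\<nu>: "sets \<nu> = sets (predictable_sigma P F)"
  using doleans by (simp add: doleans_measure_def)

lemma space_\<nu>: "space \<nu> = {0..} \<times> space P"
  using sets_eq_imp_space_eq[OF sets_\<nu>] rectangles_Pow
  by (simp add: predictable_sigma_def rectangles_def)

lemma rectangle_0: "A \<in> sets (F 0) \<Longrightarrow> {0} \<times> A \<in> sets \<nu>"
  and rectangle: "0 \<le> s \<Longrightarrow> s \<le> t \<Longrightarrow> A \<in> sets (F s) \<Longrightarrow> {s<..t} \<times> A \<in> sets \<nu>"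
  unfolding sets_\<nu> sets_predictable by (rule sigma_sets.Basic, auto simp: rectangles_def)+

lemma emeasure_rectangle_0: "A \<in> sets (F 0) \<Longrightarrow> emeasure \<nu> ({0} \<times> A) = 0"
  and emeasure_rectangle: "0 \<le> s \<Longrightarrow> s \<le> t \<Longrightarrow> A \<in> sets (F s) \<Longrightarrow>
    emeasure \<nu> ({s<..t} \<times> A) = (\<integral>\<^sup>+\<omega>. ennreal (indicator A \<omega> * (B t \<omega> - B s \<omega>)\<^sup>2) \<partial>P)"
  using doleans by (auto simp: doleans_measure_def)

lemma space_P_F: "0 \<le> s \<Longrightarrow> space P \<in> sets (F s)"
  using F_space[of s] sets.top[of "F s"] by simp

lemma emeasure_initial: "emeasure \<nu> ({0<..real n} \<times> space P) \<le> energy"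
proof -
  have "emeasure \<nu> ({0<..real n} \<times> space P)
      = (\<integral>\<^sup>+\<omega>. ennreal (indicator (space P) \<omega> * (B (real n) \<omega> - B 0 \<omega>)\<^sup>2) \<partial>P)"
    by (rule emeasure_rectangle) (auto intro: space_P_F)
  also have "\<dots> = (\<integral>\<^sup>+\<omega>. ennreal ((B (real n) \<omega>)\<^sup>2) \<partial>P)"
    by (rule nn_integral_cong_AE) (use B_0 AE_space in \<open>eventually_elim, auto simp: indicator_def\<close>)
  also have "\<dots> \<le> energy" by (rule B_energy) simp
  finally show ?thesis .
qed

lemma space_\<nu>_Un: "space \<nu> = {0} \<times> space P \<union> (\<Union>n. {0<..real n} \<times> space P)"
proof -
  have "\<exists>n. u \<le> real n" for u :: real by (rule real_arch_simple)
  then show ?thesis unfolding space_\<nu> by (auto simp: less_le)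
qed

text \<open>Since \<open>B\<close> starts at 0, the strip up to time n has mass equal to the second
  moment of \<open>B\<close> at n, which is at most \<open>energy\<close>; the slice at time 0 is
  null. The strips increase to all positive times.\<close>

sublocale \<nu>: finite_measure \<nu>
proof
  let ?I = "\<lambda>n. {0<..real n} \<times> space P"
  have sets: "?I n \<in> sets \<nu>" for n
    by (rule rectangle) (auto intro: space_P_F)
  have "emeasure \<nu> (space \<nu>) \<le> emeasure \<nu> ({0} \<times> space P) + emeasure \<nu> (\<Union>n. ?I n)"
    unfolding space_\<nu>_Un by (rule emeasure_subadditive) (use sets in \<open>auto intro: rectangle_0 space_P_F\<close>)
  also have "emeasure \<nu> ({0} \<times> space P) = 0"
    by (rule emeasure_rectangle_0) (rule space_P_F, simp)
  also have "emeasure \<nu> (\<Union>n. ?I n) = (SUP n. emeasure \<nu> (?I n))"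
    by (rule SUP_emeasure_incseq[symmetric]) (use sets in \<open>auto simp: incseq_def\<close>)
  also have "\<dots> \<le> energy"
    by (intro SUP_least emeasure_initial)
  finally show "emeasure \<nu> (space \<nu>) \<noteq> \<infinity>"
    using energy_finite by (auto simp: top_unique)
qed

text \<open>The definition of the integral only asserts that some Doleans measure exists; uniqueness
  lets every integral refer to the one fixed \<open>\<nu>\<close>.\<close>

lemma doleans_unique:
  assumes "doleans_measure P F B \<nu>'"
  shows "\<nu>' = \<nu>"
proof (rule measure_eqI_generator_eq[OF rectangles_Int_stable rectangles_Pow])
  interpret \<nu>': ito_integrator P F B \<nu>'
    by standard (use B assms in auto)
  show eq: "emeasure \<nu>' X = emeasure \<nu> X" if "X \<in> rectangles" for X
    using that unfolding rectangles_def
    by (auto simp: \<nu>'.emeasure_rectangle_0 \<nu>'.emeasure_rectangle emeasure_rectangle_0 emeasure_rectangle)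
  show "sets \<nu>' = sigma_sets ({0..} \<times> space P) rectangles"
       "sets \<nu> = sigma_sets ({0..} \<times> space P) rectangles"
    by (auto simp: \<nu>'.sets_\<nu> sets_\<nu> sets_predictable)
  \<comment> \<open>Index 0 is spent on the slice at time 0, which no strip covers.\<close>
  let ?A = "\<lambda>n. case n of 0 \<Rightarrow> {0} \<times> space P | Suc n \<Rightarrow> {0<..real n} \<times> space P"
  have "?A n \<in> rectangles" for n
  proof (cases n)
    case 0
    then show ?thesis using space_P_F[of 0] unfolding rectangles_def by auto
  next
    case (Suc k)
    have "(0::real) \<le> 0" "0 \<le> real k" "space P \<in> sets (F 0)" by (auto intro: space_P_F)
    then show ?thesis unfolding Suc rectangles_def nat.case by blast
  qed
  then show "range ?A \<subseteq> rectangles" by blast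
  show "(\<Union>n. ?A n) = {0..} \<times> space P"
  proof -
    have "(\<Union>n. ?A n) = ?A 0 \<union> (\<Union>n. ?A (Suc n))"
      by (subst UNIV_nat_eq) (simp add: image_image)
    then show ?thesis using space_\<nu>_Un by (simp add: space_\<nu>)
  qed
  show "emeasure \<nu>' (?A n) \<noteq> \<infinity>" for n
    using \<nu>'.\<nu>.emeasure_finite by simp
qed

text \<open>Completeness places \<open>N\<close> in \<open>F 0\<close>, hence in every later
  \<open>F s\<close>, so the strips over \<open>N\<close> are predictable rectangles. Their mass is
  an integral over a null set.\<close>

lemma null_evanescent:
  assumes "N \<in> null_sets P"
  shows "{0..} \<times> N \<in> null_sets \<nu>"
proof -
  have N: "N \<in> sets (F s)" if "0 \<le> s" for s
    using complete[OF assms order_refl] F_mono[OF order_refl that] by blast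
  have "\<exists>n. u \<le> real n" for u :: real by (rule real_arch_simple)
  then have eq: "{0..} \<times> N = {0} \<times> N \<union> (\<Union>n. {0<..real n} \<times> N)"
    by (auto simp: less_le)
  have AE_N: "AE \<omega> in P. \<omega> \<notin> N" using assms by (rule AE_not_in)
  have "{0} \<times> N \<in> null_sets \<nu>"
    by (intro null_setsI emeasure_rectangle_0 rectangle_0 N) simp_all
  moreover have "{0<..real n} \<times> N \<in> null_sets \<nu>" for n
  proof (rule null_setsI)
    have "emeasure \<nu> ({0<..real n} \<times> N) = (\<integral>\<^sup>+\<omega>. ennreal (indicator N \<omega> * (B (real n) \<omega> - B 0 \<omega>)\<^sup>2) \<partial>P)"
      by (rule emeasure_rectangle) (auto intro: N)
    also have "\<dots> = (\<integral>\<^sup>+\<omega>. 0 \<partial>P)"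
      by (rule nn_integral_cong_AE) (use AE_N in \<open>eventually_elim, simp\<close>)
    finally show "emeasure \<nu> ({0<..real n} \<times> N) = 0" by simp
  qed (auto intro: rectangle N)
  ultimately show ?thesis
    unfolding eq by (intro null_sets.Un null_sets_UN) auto
qed

lemma AE_evanescent:
  assumes "AE \<omega> in P. Q \<omega>"
  shows "AE (t, \<omega>) in \<nu>. Q \<omega>"
proof -
  obtain N where N: "{\<omega> \<in> space P. \<not> Q \<omega>} \<subseteq> N" "N \<in> null_sets P"
    using assms by (auto elim!: AE_E2[where P = Q] AE_E intro: null_setsI)
  show ?thesis
    by (rule AE_I'[OF null_evanescent[OF N(2)]]) (use N(1) in \<open>auto simp: space_\<nu>\<close>)
qed

lemma elementary_indicator_measurable:
  fixes \<xi> :: "'a \<Rightarrow> real"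
  assumes "0 \<le> s" "s \<le> t" "\<xi> \<in> borel_measurable (F s)"
  shows "(\<lambda>(u, \<omega>). \<xi> \<omega> * indicator {s<..t} u) \<in> borel_measurable \<nu>"
proof (rule borel_measurableI)
  fix S :: "real set" assume "open S"
  let ?R = "{s<..t} \<times> (\<xi> -` S \<inter> space P)" and ?T = "{s<..t} \<times> space P"
  have R: "?R \<in> sets \<nu>" "?T \<in> sets \<nu>"
    using assms measurable_sets[OF assms(3), of S] \<open>open S\<close>
    by (auto intro!: rectangle space_P_F simp: F_space)
  have "(\<lambda>(u, \<omega>). \<xi> \<omega> * indicator {s<..t} u) = (\<lambda>(u, \<omega>). if u \<in> {s<..t} then \<xi> \<omega> else 0)"
    by (simp add: fun_eq_iff)
  \<comment> \<open>The process is 0 off the strip, so the complement belongs to the preimage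
    exactly when \<open>S\<close> contains 0.\<close>
  then have "(\<lambda>(u, \<omega>). \<xi> \<omega> * indicator {s<..t} u) -` S \<inter> space \<nu>
      = ?R \<union> (if 0 \<in> S then space \<nu> - ?T else {})"
    using assms by (auto simp: space_\<nu> split: if_splits)
  then show "(\<lambda>(u, \<omega>). \<xi> \<omega> * indicator {s<..t} u) -` S \<inter> space \<nu> \<in> sets \<nu>"
    using R by simp
qed

text \<open>This extends the defining property of the Doleans measure from events to
  \<open>F a\<close>-measurable factors. Both sides integrate \<open>\<zeta>\<close> against
  measures on \<open>F a\<close>: the image of \<open>\<nu>\<close> on the strip under the second
  projection, and P weighted by the squared increment. These agree on every event of
  \<open>F a\<close>, so the equality of integrals needs no integrability of
  \<open>\<zeta>\<close>.\<close>

lemma integral_increment_square: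
  assumes "0 \<le> a" "a \<le> b" "\<zeta> \<in> borel_measurable (F a)"
  shows "(LINT \<omega>|P. \<zeta> \<omega> * (B b \<omega> - B a \<omega>)\<^sup>2) = (LINT (u, \<omega>)|\<nu>. \<zeta> \<omega> * indicator {a<..b} u)"
proof -
  let ?R = "{a<..b} \<times> space P"
  let ?q = "\<lambda>\<omega>. (B b \<omega> - B a \<omega>)\<^sup>2"
  have [measurable]: "B a \<in> borel_measurable P" "B b \<in> borel_measurable P"
    using assms by (auto intro: B_borel)
  have \<zeta>: "\<zeta> \<in> borel_measurable P" using F_borel assms by blast
  have R: "?R \<in> sets \<nu>" using assms by (intro rectangle space_P_F)
  have R_space: "?R \<subseteq> space \<nu>" using assms by (auto simp: space_\<nu>)
  have snd: "snd \<in> measurable (restrict_space \<nu> ?R) (F a)"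
  proof (rule measurableI)
    show "snd z \<in> space (F a)" if "z \<in> space (restrict_space \<nu> ?R)" for z
      using that assms by (auto simp: space_restrict_space F_space)
    fix A assume A: "A \<in> sets (F a)"
    then have "A \<subseteq> space P" using sets.sets_into_space F_space assms by blast
    then have "snd -` A \<inter> space (restrict_space \<nu> ?R) = {a<..b} \<times> A"
      using R_space by (auto simp: space_restrict_space)
    then show "snd -` A \<inter> space (restrict_space \<nu> ?R) \<in> sets (restrict_space \<nu> ?R)"
      using R A assms \<open>A \<subseteq> space P\<close> by (auto simp: sets_restrict_space_iff intro: rectangle)
  qed
  have id: "(\<lambda>\<omega>. \<omega>) \<in> measurable (density P (\<lambda>\<omega>. ennreal (?q \<omega>))) (F a)"
    using assms by (auto simp: measurable_def F_space dest: F_subset[THEN subsetD] sets.sets_into_space)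
  have eq: "distr (restrict_space \<nu> ?R) (F a) snd = distr (density P (\<lambda>\<omega>. ennreal (?q \<omega>))) (F a) (\<lambda>\<omega>. \<omega>)"
  proof (rule measure_eqI)
    fix A assume "A \<in> sets (distr (restrict_space \<nu> ?R) (F a) snd)"
    then have A: "A \<in> sets (F a)" by simp
    then have sub: "A \<subseteq> space P"
      using sets.sets_into_space[OF A] F_space[OF assms(1)] by simp
    have AP: "A \<in> sets P"
      using F_subset[OF assms(1)] A by blast
    have "snd -` A \<inter> space (restrict_space \<nu> ?R) = {a<..b} \<times> A"
      using R_space sub by (auto simp: space_restrict_space)
    then have "emeasure (distr (restrict_space \<nu> ?R) (F a) snd) A = emeasure (restrict_space \<nu> ?R) ({a<..b} \<times> A)"
      by (simp add: emeasure_distr[OF snd A])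
    also have "\<dots> = emeasure \<nu> ({a<..b} \<times> A)"
      using R sub by (intro emeasure_restrict_space) auto
    also have "\<dots> = (\<integral>\<^sup>+\<omega>. ennreal (indicator A \<omega> * ?q \<omega>) \<partial>P)"
      using assms A by (intro emeasure_rectangle)
    also have "\<dots> = (\<integral>\<^sup>+\<omega>. ennreal (?q \<omega>) * indicator A \<omega> \<partial>P)"
      by (intro nn_integral_cong) (auto simp: indicator_def)
    also have "\<dots> = emeasure (density P (\<lambda>\<omega>. ennreal (?q \<omega>))) A"
      using AP by (intro emeasure_density[symmetric]) measurable
    also have "\<dots> = emeasure (distr (density P (\<lambda>\<omega>. ennreal (?q \<omega>))) (F a) (\<lambda>\<omega>. \<omega>)) A"
      using sub by (simp add: emeasure_distr[OF id A] Int_absorb2)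
    finally show "emeasure (distr (restrict_space \<nu> ?R) (F a) snd) A
      = emeasure (distr (density P (\<lambda>\<omega>. ennreal (?q \<omega>))) (F a) (\<lambda>\<omega>. \<omega>)) A" .
  qed simp
  have "(LINT \<omega>|P. \<zeta> \<omega> * ?q \<omega>) = (LINT \<omega>|P. ?q \<omega> *\<^sub>R \<zeta> \<omega>)"
    by (simp add: mult.commute)
  also have "\<dots> = (LINT \<omega>|density P (\<lambda>\<omega>. ennreal (?q \<omega>)). \<zeta> \<omega>)"
    by (rule integral_density[symmetric]) (use \<zeta> in auto)
  also have "\<dots> = (LINT \<omega>|distr (density P (\<lambda>\<omega>. ennreal (?q \<omega>))) (F a) (\<lambda>\<omega>. \<omega>). \<zeta> \<omega>)"
    by (rule integral_distr[OF id assms(3), symmetric])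
  also have "\<dots> = (LINT z|restrict_space \<nu> ?R. \<zeta> (snd z))"
    unfolding eq[symmetric] by (rule integral_distr[OF snd assms(3)])
  also have "\<dots> = (LINT z|\<nu>. indicator ?R z *\<^sub>R \<zeta> (snd z))"
    by (rule integral_restrict_space) (use R in auto)
  also have "\<dots> = (LINT (u, \<omega>)|\<nu>. \<zeta> \<omega> * indicator {a<..b} u)"
    by (intro Bochner_Integration.integral_cong) (auto simp: space_\<nu> indicator_def)
  finally show ?thesis .
qed

section \<open>The isometry for elementary integrands\<close>

definition elem1 :: "real \<Rightarrow> real \<Rightarrow> ('a \<Rightarrow> real) \<Rightarrow> bool" where
  "elem1 s t \<xi> \<longleftrightarrow> 0 \<le> s \<and> s \<le> t \<and> \<xi> \<in> borel_measurable (F s) \<and> (\<exists>c. \<forall>\<omega>\<in>space P. \<bar>\<xi> \<omega>\<bar> \<le> c)"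

lemma elem1_L2_P:
  assumes "elem1 s t \<xi>"
  shows "(\<lambda>\<omega>. \<xi> \<omega> * (B t \<omega> - B s \<omega>)) \<in> L2 P"
proof -
  obtain c where c: "\<And>\<omega>. \<omega> \<in> space P \<Longrightarrow> \<bar>\<xi> \<omega>\<bar> \<le> c" and st: "0 \<le> s" "s \<le> t" "\<xi> \<in> borel_measurable (F s)"
    using assms by (auto simp: elem1_def)
  have L: "(\<lambda>\<omega>. B t \<omega> - B s \<omega>) \<in> L2 P"
    using st by (intro L2_diff B_L2) auto
  show ?thesis
  proof (rule L2_bounded_by[OF L2_scale[OF L, of c]])
    show "(\<lambda>\<omega>. \<xi> \<omega> * (B t \<omega> - B s \<omega>)) \<in> borel_measurable P"
      using F_borel[OF st(3,1)] L by measurable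
    show "AE \<omega> in P. \<bar>\<xi> \<omega> * (B t \<omega> - B s \<omega>)\<bar> \<le> \<bar>c * (B t \<omega> - B s \<omega>)\<bar>"
      by (rule AE_I2) (use c in \<open>force simp: abs_mult intro!: mult_right_mono\<close>)
  qed
qed

lemma elem1_L2_\<nu>:
  assumes "elem1 s t \<xi>"
  shows "(\<lambda>(u, \<omega>). \<xi> \<omega> * indicator {s<..t} u) \<in> L2 \<nu>"
proof -
  obtain c where c: "\<And>\<omega>. \<omega> \<in> space P \<Longrightarrow> \<bar>\<xi> \<omega>\<bar> \<le> c" and st: "0 \<le> s" "s \<le> t" "\<xi> \<in> borel_measurable (F s)"
    using assms by (auto simp: elem1_def)
  show ?thesis
    by (rule L2_bounded[OF \<nu>.finite_measure_axioms elementary_indicator_measurable[OF st], of "\<bar>c\<bar>"])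
      (use c in \<open>force simp: space_\<nu> indicator_def\<close>)
qed

lemma elem1_mono: "elem1 s t \<xi> \<Longrightarrow> s \<le> s' \<Longrightarrow> s' \<le> t' \<Longrightarrow> elem1 s' t' \<xi>"
  unfolding elem1_def by (auto intro: F_borel_mono)

text \<open>The whole earlier term and the later coefficient are known at time \<open>s'\<close>;
  together they form the variable against which the later increment is centred. Boundedness of
  \<open>\<xi>'\<close> keeps it in L2.\<close>

lemma elem1_orthogonal:
  assumes 1: "elem1 s t \<xi>" and 2: "elem1 s' t' \<xi>'" and "t \<le> s'"
  shows "(LINT \<omega>|P. (\<xi> \<omega> * (B t \<omega> - B s \<omega>)) * (\<xi>' \<omega> * (B t' \<omega> - B s' \<omega>))) = 0"
proof -
  obtain c' where c': "\<And>\<omega>. \<omega> \<in> space P \<Longrightarrow> \<bar>\<xi>' \<omega>\<bar> \<le> c'"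
    using 2 by (auto simp: elem1_def)
  have m: "\<xi> \<in> borel_measurable (F s')" "B t \<in> borel_measurable (F s')" "B s \<in> borel_measurable (F s')"
    "\<xi>' \<in> borel_measurable (F s')"
    using 1 2 \<open>t \<le> s'\<close> B_F[of t] B_F[of s] by (auto simp: elem1_def intro: F_borel_mono)
  let ?Z = "\<lambda>\<omega>. \<xi>' \<omega> * (\<xi> \<omega> * (B t \<omega> - B s \<omega>))"
  have Z: "?Z \<in> borel_measurable (F s')"
    using m by measurable
  have "?Z \<in> L2 P"
  proof (rule L2_bounded_by[OF L2_scale[OF elem1_L2_P[OF 1], of c']])
    show "?Z \<in> borel_measurable P"
      using Z F_borel 2 by (auto simp: elem1_def)
    show "AE \<omega> in P. \<bar>?Z \<omega>\<bar> \<le> \<bar>c' * (\<xi> \<omega> * (B t \<omega> - B s \<omega>))\<bar>"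
      by (rule AE_I2) (use c' in \<open>force simp: abs_mult intro!: mult_right_mono\<close>)
  qed
  then have "(LINT \<omega>|P. ?Z \<omega> * (B t' \<omega> - B s' \<omega>)) = 0"
    using 2 Z by (intro increment_orthogonal) (auto simp: elem1_def)
  then show ?thesis by (simp add: algebra_simps)
qed

text \<open>Intervals that overlap are both cut at the ends of the overlap \<open>{a<..b}\<close>.
  Of the nine products of pieces only the one with both factors on the overlap survives, and there
  the formula for squared increments applies.\<close>

lemma elem1_inner:
  assumes 1: "elem1 s t \<xi>" and 2: "elem1 s' t' \<xi>'"
  shows "(LINT \<omega>|P. (\<xi> \<omega> * (B t \<omega> - B s \<omega>)) * (\<xi>' \<omega> * (B t' \<omega> - B s' \<omega>)))
    = (LINT (u, \<omega>)|\<nu>. (\<xi> \<omega> * indicator {s<..t} u) * (\<xi>' \<omega> * indicator {s'<..t'} u))"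
proof (cases "t \<le> s' \<or> t' \<le> s")
  case True
  have "(LINT \<omega>|P. (\<xi> \<omega> * (B t \<omega> - B s \<omega>)) * (\<xi>' \<omega> * (B t' \<omega> - B s' \<omega>))) = 0"
    using True elem1_orthogonal[OF 1 2] elem1_orthogonal[OF 2 1] by (auto simp: mult.commute)
  moreover have "(\<lambda>(u, \<omega>). (\<xi> \<omega> * indicator {s<..t} u) * (\<xi>' \<omega> * indicator {s'<..t'} u)) = (\<lambda>_. 0)"
    using True by (auto simp: indicator_def fun_eq_iff)
  ultimately show ?thesis by simp
next
  case False
  define a where "a = max s s'"
  define b where "b = min t t'"
  have ab: "0 \<le> a" "a \<le> b" "s \<le> a" "s' \<le> a" "b \<le> t" "b \<le> t'"
    using False 1 2 by (auto simp: a_def b_def elem1_def)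
  have e: "elem1 b t \<xi>" "elem1 a b \<xi>" "elem1 s a \<xi>" "elem1 b t' \<xi>'" "elem1 a b \<xi>'" "elem1 s' a \<xi>'"
    using elem1_mono[OF 1] elem1_mono[OF 2] ab by auto
  define X where "X p q \<omega> = \<xi> \<omega> * (B q \<omega> - B p \<omega>)" for p q \<omega>
  define X' where "X' p q \<omega> = \<xi>' \<omega> * (B q \<omega> - B p \<omega>)" for p q \<omega>
  have L: "X b t \<in> L2 P" "X a b \<in> L2 P" "X s a \<in> L2 P" "X' b t' \<in> L2 P" "X' a b \<in> L2 P" "X' s' a \<in> L2 P"
    unfolding X_def X'_def by (rule elem1_L2_P, rule e)+
  \<comment> \<open>\<open>b\<close> is one of \<open>t\<close> and \<open>t'\<close>, so one factor
    is an increment over an empty interval; for \<open>a\<close> the same happens at the left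
    ends.\<close>
  have z1: "(LINT \<omega>|P. X b t \<omega> * X' b t' \<omega>) = 0"
    by (cases "t \<le> t'") (auto simp: X_def X'_def b_def min_def)
  have z2: "(LINT \<omega>|P. X s a \<omega> * X' s' a \<omega>) = 0"
    by (cases "s \<le> s'") (auto simp: X_def X'_def a_def max_def)
  have z: "(LINT \<omega>|P. X b t \<omega> * X' a b \<omega>) = 0" "(LINT \<omega>|P. X b t \<omega> * X' s' a \<omega>) = 0"
    "(LINT \<omega>|P. X a b \<omega> * X' b t' \<omega>) = 0" "(LINT \<omega>|P. X a b \<omega> * X' s' a \<omega>) = 0"
    "(LINT \<omega>|P. X s a \<omega> * X' b t' \<omega>) = 0" "(LINT \<omega>|P. X s a \<omega> * X' a b \<omega>) = 0"
    using elem1_orthogonal[OF e(5) e(1)] elem1_orthogonal[OF e(6) e(1)] elem1_orthogonal[OF e(2) e(4)]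
      elem1_orthogonal[OF e(6) e(2)] elem1_orthogonal[OF e(3) e(4)] elem1_orthogonal[OF e(3) e(5)] ab
    by (auto simp: X_def X'_def mult.commute)
  have "(LINT \<omega>|P. (\<xi> \<omega> * (B t \<omega> - B s \<omega>)) * (\<xi>' \<omega> * (B t' \<omega> - B s' \<omega>)))
    = (LINT \<omega>|P. X b t \<omega> * X' b t' \<omega> + X b t \<omega> * X' a b \<omega> + X b t \<omega> * X' s' a \<omega>
      + (X a b \<omega> * X' b t' \<omega> + X a b \<omega> * X' a b \<omega> + X a b \<omega> * X' s' a \<omega>)
      + (X s a \<omega> * X' b t' \<omega> + X s a \<omega> * X' a b \<omega> + X s a \<omega> * X' s' a \<omega>))"
    by (rule Bochner_Integration.integral_cong) (auto simp: X_def X'_def algebra_simps)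
  also have "\<dots> = (LINT \<omega>|P. X a b \<omega> * X' a b \<omega>)"
    by (simp add: L L2_mult_integrable z z1 z2)
  also have "\<dots> = (LINT \<omega>|P. (\<xi> \<omega> * \<xi>' \<omega>) * (B b \<omega> - B a \<omega>)\<^sup>2)"
    by (simp add: X_def X'_def power2_eq_square algebra_simps)
  also have "\<dots> = (LINT (u, \<omega>)|\<nu>. (\<xi> \<omega> * \<xi>' \<omega>) * indicator {a<..b} u)"
    using e(2,5) by (intro integral_increment_square) (auto simp: elem1_def)
  also have "\<dots> = (LINT (u, \<omega>)|\<nu>. (\<xi> \<omega> * indicator {s<..t} u) * (\<xi>' \<omega> * indicator {s'<..t'} u))"
    by (intro Bochner_Integration.integral_cong) (auto simp: a_def b_def indicator_def)
  finally show ?thesis .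
qed

lemma elementary_Nil [simp]: "elementary P F []"
  by (simp add: elementary_def)

lemma elementary_Cons: "elementary P F ((s, t, \<xi>) # es) \<longleftrightarrow> elem1 s t \<xi> \<and> elementary P F es"
  by (auto simp: elementary_def elem1_def)

lemma elementary_integral_Cons:
  "elementary_integral B ((s, t, \<xi>) # es) = (\<lambda>\<omega>. \<xi> \<omega> * (B t \<omega> - B s \<omega>) + elementary_integral B es \<omega>)"
  by (simp add: elementary_integral_def fun_eq_iff)

definition eproc :: "(real \<times> real \<times> ('a \<Rightarrow> real)) list \<Rightarrow> real \<times> 'a \<Rightarrow> real" where
  "eproc es z = elementary_process es (fst z) (snd z)"

lemma eproc_Cons:
  "eproc ((s, t, \<xi>) # es) = (\<lambda>z. (case z of (u, \<omega>) \<Rightarrow> \<xi> \<omega> * indicator {s<..t} u) + eproc es z)"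
  by (simp add: eproc_def elementary_process_def fun_eq_iff)

lemma eproc_Nil: "eproc [] = (\<lambda>z. 0)"
  and elementary_integral_Nil: "elementary_integral B [] = (\<lambda>\<omega>. 0)"
  by (simp_all add: eproc_def elementary_process_def elementary_integral_def fun_eq_iff)

lemma elementary_L2:
  assumes "elementary P F es"
  shows "eproc es \<in> L2 \<nu>" "elementary_integral B es \<in> L2 P"
proof -
  have "eproc es \<in> L2 \<nu> \<and> elementary_integral B es \<in> L2 P"
    using assms
  proof (induction es)
    case (Cons e es)
    then show ?case
      by (cases e) (auto simp: elementary_Cons eproc_Cons elementary_integral_Cons
          intro!: L2_add elem1_L2_P elem1_L2_\<nu>)
  qed (simp add: eproc_Nil elementary_integral_Nil L2_zero)
  then show "eproc es \<in> L2 \<nu>" "elementary_integral B es \<in> L2 P" by auto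
qed

lemma elem1_elementary_inner:
  assumes "elem1 s t \<xi>" "elementary P F es"
  shows "(LINT \<omega>|P. (\<xi> \<omega> * (B t \<omega> - B s \<omega>)) * elementary_integral B es \<omega>)
    = (LINT z|\<nu>. (case z of (u, \<omega>) \<Rightarrow> \<xi> \<omega> * indicator {s<..t} u) * eproc es z)"
  using assms(2)
proof (induction es)
  case (Cons e es)
  obtain s' t' \<xi>' where e: "e = (s', t', \<xi>')" by (cases e)
  have *: "elem1 s' t' \<xi>'" "elementary P F es" using Cons by (auto simp: e elementary_Cons)
  have "(LINT z|\<nu>. (case z of (u, \<omega>) \<Rightarrow> \<xi> \<omega> * indicator {s<..t} u) *
        (case z of (u, \<omega>) \<Rightarrow> \<xi>' \<omega> * indicator {s'<..t'} u))
      = (LINT \<omega>|P. (\<xi> \<omega> * (B t \<omega> - B s \<omega>)) * (\<xi>' \<omega> * (B t' \<omega> - B s' \<omega>)))"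
    unfolding elem1_inner[OF assms(1) *(1)]
    by (rule Bochner_Integration.integral_cong) auto
  then show ?case
    using Cons.IH[OF *(2)] L2_mult_integrable[OF elem1_L2_P[OF assms(1)] elem1_L2_P[OF *(1)]]
      L2_mult_integrable[OF elem1_L2_P[OF assms(1)] elementary_L2(2)[OF *(2)]]
      L2_mult_integrable[OF elem1_L2_\<nu>[OF assms(1)] elem1_L2_\<nu>[OF *(1)]]
      L2_mult_integrable[OF elem1_L2_\<nu>[OF assms(1)] elementary_L2(1)[OF *(2)]]
    unfolding e eproc_Cons elementary_integral_Cons ring_distribs
    by simp
qed (simp add: eproc_Nil elementary_integral_Nil)

text \<open>Bilinearity, by one induction for each list, reduces this to pairs of single steps. The
  intervals within a list may therefore overlap, and no common refinement of the time axis has to be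
  built.\<close>

lemma elementary_inner:
  assumes "elementary P F es" "elementary P F es'"
  shows "(LINT \<omega>|P. elementary_integral B es \<omega> * elementary_integral B es' \<omega>)
    = (LINT z|\<nu>. eproc es z * eproc es' z)"
  using assms(1)
proof (induction es)
  case (Cons e es)
  obtain s t \<xi> where e: "e = (s, t, \<xi>)" by (cases e)
  have *: "elem1 s t \<xi>" "elementary P F es" using Cons by (auto simp: e elementary_Cons)
  show ?case
    using Cons.IH[OF *(2)] elem1_elementary_inner[OF *(1) assms(2)]
      L2_mult_integrable[OF elem1_L2_P[OF *(1)] elementary_L2(2)[OF assms(2)]]
      L2_mult_integrable[OF elementary_L2(2)[OF *(2)] elementary_L2(2)[OF assms(2)]]
      L2_mult_integrable[OF elem1_L2_\<nu>[OF *(1)] elementary_L2(1)[OF assms(2)]]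
      L2_mult_integrable[OF elementary_L2(1)[OF *(2)] elementary_L2(1)[OF assms(2)]]
    unfolding e eproc_Cons elementary_integral_Cons ring_distribs
    by simp
qed (simp add: eproc_Nil elementary_integral_Nil)

lemma elementary_isometry:
  assumes "elementary P F es"
  shows "L2_norm \<nu> (eproc es) = L2_norm P (elementary_integral B es)"
  using elementary_inner[OF assms assms] by (simp add: L2_norm_def power2_eq_square)

end

section \<open>Extension of the integral to all of L2(nu)\<close>

context ito_integrator
begin

text \<open>The closure of the graph of the elementary integral in the product of L2(nu) and L2(P):
  one and the same list must approximate both components. A relation is used because integrals are
  determined only up to almost sure equality.\<close>

definition ito :: "(real \<times> 'a \<Rightarrow> real) \<Rightarrow> ('a \<Rightarrow> real) \<Rightarrow> bool" where
  "ito f Y \<longleftrightarrow> f \<in> L2 \<nu> \<and> Y \<in> L2 P \<and>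
     (\<forall>e>0. \<exists>es. elementary P F es \<and> L2_norm \<nu> (\<lambda>z. f z - eproc es z) < e \<and>
        L2_norm P (\<lambda>\<omega>. Y \<omega> - elementary_integral B es \<omega>) < e)"

lemma ito_L2: "ito f Y \<Longrightarrow> f \<in> L2 \<nu>" "ito f Y \<Longrightarrow> Y \<in> L2 P"
  by (auto simp: ito_def)

lemma ito_elementary:
  assumes "elementary P F es" shows "ito (eproc es) (elementary_integral B es)"
  unfolding ito_def using assms elementary_L2[OF assms]
  by (auto simp: L2_norm_def intro!: exI[of _ es])

lemma elementary_append:
  "elementary P F (es @ es') \<longleftrightarrow> elementary P F es \<and> elementary P F es'"
  "eproc (es @ es') z = eproc es z + eproc es' z"
  "elementary_integral B (es @ es') \<omega> = elementary_integral B es \<omega> + elementary_integral B es' \<omega>"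
  by (simp_all add: elementary_def ball_Un eproc_def elementary_process_def elementary_integral_def)

lemma elementary_scale:
  assumes "elementary P F es"
  obtains es' where "elementary P F es'" "eproc es' = (\<lambda>z. c * eproc es z)"
    "elementary_integral B es' = (\<lambda>\<omega>. c * elementary_integral B es \<omega>)"
proof -
  have "\<exists>es'. elementary P F es' \<and> eproc es' = (\<lambda>z. c * eproc es z) \<and>
    elementary_integral B es' = (\<lambda>\<omega>. c * elementary_integral B es \<omega>)"
    using assms
  proof (induction es)
    case Nil
    then show ?case by (intro exI[of _ "[]"]) (auto simp: eproc_Nil elementary_integral_Nil)
  next
    case (Cons e es)
    obtain s t \<xi> where e: "e = (s, t, \<xi>)" by (cases e)
    have *: "elem1 s t \<xi>" "elementary P F es" using Cons by (auto simp: e elementary_Cons)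
    obtain es' where es': "elementary P F es'" "eproc es' = (\<lambda>z. c * eproc es z)"
      "elementary_integral B es' = (\<lambda>\<omega>. c * elementary_integral B es \<omega>)"
      using Cons.IH[OF *(2)] by blast
    obtain C where C: "\<And>\<omega>. \<omega> \<in> space P \<Longrightarrow> \<bar>\<xi> \<omega>\<bar> \<le> C" using *(1) by (auto simp: elem1_def)
    have "\<bar>c * \<xi> \<omega>\<bar> \<le> \<bar>c\<bar> * C" if "\<omega> \<in> space P" for \<omega>
      using C[OF that] by (simp add: abs_mult mult_left_mono)
    then have "elem1 s t (\<lambda>\<omega>. c * \<xi> \<omega>)"
      using *(1) by (auto simp: elem1_def)
    then show ?case
      using es' by (intro exI[of _ "(s, t, \<lambda>\<omega>. c * \<xi> \<omega>) # es'"])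
        (auto simp: e elementary_Cons eproc_Cons elementary_integral_Cons algebra_simps fun_eq_iff)
  qed
  then show ?thesis using that by blast
qed

lemma ito_add:
  assumes "ito f Y" "ito g Z"
  shows "ito (\<lambda>z. f z + g z) (\<lambda>\<omega>. Y \<omega> + Z \<omega>)"
  unfolding ito_def
proof (intro conjI allI impI)
  fix e :: real assume "0 < e"
  then have e2: "0 < e / 2" by simp
  obtain es where es: "elementary P F es" "L2_norm \<nu> (\<lambda>z. f z - eproc es z) < e / 2"
      "L2_norm P (\<lambda>\<omega>. Y \<omega> - elementary_integral B es \<omega>) < e / 2"
    using assms(1) e2 unfolding ito_def by blast
  obtain es' where es': "elementary P F es'" "L2_norm \<nu> (\<lambda>z. g z - eproc es' z) < e / 2"
      "L2_norm P (\<lambda>\<omega>. Z \<omega> - elementary_integral B es' \<omega>) < e / 2"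
    using assms(2) e2 unfolding ito_def by blast
  note L = elementary_L2[OF es(1)] elementary_L2[OF es'(1)] ito_L2[OF assms(1)] ito_L2[OF assms(2)]
  have "L2_norm \<nu> (\<lambda>z. (f z + g z) - eproc (es @ es') z) < e"
    using L2_norm_triangle[OF L2_diff[OF L(5,1)] L2_diff[OF L(7,3)]] es(2) es'(2)
    by (simp add: elementary_append algebra_simps)
  moreover have "L2_norm P (\<lambda>\<omega>. (Y \<omega> + Z \<omega>) - elementary_integral B (es @ es') \<omega>) < e"
    using L2_norm_triangle[OF L2_diff[OF L(6,2)] L2_diff[OF L(8,4)]] es(3) es'(3)
    by (simp add: elementary_append algebra_simps)
  ultimately show "\<exists>es. elementary P F es \<and> L2_norm \<nu> (\<lambda>z. (f z + g z) - eproc es z) < e \<and>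
        L2_norm P (\<lambda>\<omega>. (Y \<omega> + Z \<omega>) - elementary_integral B es \<omega>) < e"
    using es(1) es'(1) by (intro exI[of _ "es @ es'"]) (simp add: elementary_append)
qed (use assms in \<open>auto intro: L2_add ito_L2\<close>)

lemma ito_scale:
  assumes "ito f Y"
  shows "ito (\<lambda>z. c * f z) (\<lambda>\<omega>. c * Y \<omega>)"
  unfolding ito_def
proof (intro conjI allI impI)
  fix e :: real assume "0 < e"
  then have "0 < e / (\<bar>c\<bar> + 1)" by simp
  then obtain es where es: "elementary P F es" "L2_norm \<nu> (\<lambda>z. f z - eproc es z) < e / (\<bar>c\<bar> + 1)"
      "L2_norm P (\<lambda>\<omega>. Y \<omega> - elementary_integral B es \<omega>) < e / (\<bar>c\<bar> + 1)"
    using assms unfolding ito_def by blast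
  obtain es' where es': "elementary P F es'" "eproc es' = (\<lambda>z. c * eproc es z)"
    "elementary_integral B es' = (\<lambda>\<omega>. c * elementary_integral B es \<omega>)"
    using elementary_scale[OF es(1)] .
  have *: "\<bar>c\<bar> * x < e" if "x < e / (\<bar>c\<bar> + 1)" "0 \<le> x" for x
    using that \<open>0 < e\<close> by (simp add: field_simps)
  have "L2_norm \<nu> (\<lambda>z. c * f z - eproc es' z) < e"
    using *[OF es(2)] unfolding es'(2) L2_norm_scale[symmetric] by (simp add: right_diff_distrib)
  moreover have "L2_norm P (\<lambda>\<omega>. c * Y \<omega> - elementary_integral B es' \<omega>) < e"
    using *[OF es(3)] unfolding es'(3) L2_norm_scale[symmetric] by (simp add: right_diff_distrib)
  ultimately show "\<exists>es. elementary P F es \<and> L2_norm \<nu> (\<lambda>z. c * f z - eproc es z) < e \<and>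
        L2_norm P (\<lambda>\<omega>. c * Y \<omega> - elementary_integral B es \<omega>) < e"
    using es'(1) by blast
qed (use assms in \<open>auto intro: L2_scale ito_L2\<close>)

lemma ito_diff:
  assumes "ito f Y" "ito g Z"
  shows "ito (\<lambda>z. f z - g z) (\<lambda>\<omega>. Y \<omega> - Z \<omega>)"
  using ito_add[OF assms(1) ito_scale[OF assms(2), of "-1"]] by simp

lemma ito_isometry:
  assumes "ito f Y"
  shows "L2_norm \<nu> f = L2_norm P Y"
proof -
  have "\<bar>L2_norm \<nu> f - L2_norm P Y\<bar> \<le> e" if "0 < e" for e
  proof -
    have "0 < e / 2" using that by simp
    then obtain es where es: "elementary P F es" "L2_norm \<nu> (\<lambda>z. f z - eproc es z) < e / 2"
        "L2_norm P (\<lambda>\<omega>. Y \<omega> - elementary_integral B es \<omega>) < e / 2"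
      using assms unfolding ito_def by blast
    have tri: "\<bar>L2_norm M u - L2_norm M v\<bar> \<le> L2_norm M (\<lambda>x. u x - v x)"
      if "u \<in> L2 M" "v \<in> L2 M" for M :: "'c measure" and u v
      using L2_norm_triangle[OF L2_diff[OF that] that(2)] L2_norm_triangle[OF L2_diff[OF that(2,1)] that(1)]
        L2_norm_minus_commute[of M u v] by simp
    show ?thesis
      using tri[OF ito_L2(1)[OF assms] elementary_L2(1)[OF es(1)]]
        tri[OF ito_L2(2)[OF assms] elementary_L2(2)[OF es(1)]]
        elementary_isometry[OF es(1)] es(2,3) by linarith
  qed
  from field_le_epsilon[of "\<bar>L2_norm \<nu> f - L2_norm P Y\<bar>" 0] this show ?thesis by simp
qed

text \<open>Polarisation: the norms of \<open>f\<close>, \<open>g\<close> and their sum determine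
  the inner product.\<close>

lemma ito_inner:
  assumes "ito f Y" "ito g Z"
  shows "(LINT \<omega>|P. Y \<omega> * Z \<omega>) = (LINT z|\<nu>. f z * g z)"
  using L2_norm_add_sq[OF ito_L2(1)[OF assms(1)] ito_L2(1)[OF assms(2)]]
    L2_norm_add_sq[OF ito_L2(2)[OF assms(1)] ito_L2(2)[OF assms(2)]]
    ito_isometry[OF ito_add[OF assms]] ito_isometry[OF assms(1)] ito_isometry[OF assms(2)]
  by simp

lemma ito_closed:
  fixes f :: "nat \<Rightarrow> real \<times> 'a \<Rightarrow> real"
  assumes ito: "\<And>n. ito (f n) (Y n)" and L: "g \<in> L2 \<nu>" "Z \<in> L2 P"
    and lim: "(\<lambda>n. L2_norm \<nu> (\<lambda>z. f n z - g z)) \<longlonglongrightarrow> 0" "(\<lambda>n. L2_norm P (\<lambda>\<omega>. Y n \<omega> - Z \<omega>)) \<longlonglongrightarrow> 0"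
  shows "ito g Z"
  unfolding ito_def
proof (intro conjI allI impI L)
  fix e :: real assume "0 < e"
  then have e2: "0 < e / 2" by simp
  have "\<forall>\<^sub>F n in sequentially. L2_norm \<nu> (\<lambda>z. f n z - g z) < e / 2 \<and> L2_norm P (\<lambda>\<omega>. Y n \<omega> - Z \<omega>) < e / 2"
    by (intro eventually_conj order_tendstoD(2)[OF lim(1) e2] order_tendstoD(2)[OF lim(2) e2])
  then obtain n where n: "L2_norm \<nu> (\<lambda>z. f n z - g z) < e / 2" "L2_norm P (\<lambda>\<omega>. Y n \<omega> - Z \<omega>) < e / 2"
    using eventually_happens'[OF sequentially_bot] by blast
  obtain es where es: "elementary P F es" "L2_norm \<nu> (\<lambda>z. f n z - eproc es z) < e / 2"
      "L2_norm P (\<lambda>\<omega>. Y n \<omega> - elementary_integral B es \<omega>) < e / 2"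
    using ito[of n] e2 unfolding ito_def by blast
  have "L2_norm \<nu> (\<lambda>z. g z - eproc es z) < e"
    using L2_norm_triangle_diff[OF L(1) ito_L2(1)[OF ito] elementary_L2(1)[OF es(1)], of n]
      L2_norm_minus_commute[of \<nu> g "f n"] n(1) es(2) by linarith
  moreover have "L2_norm P (\<lambda>\<omega>. Z \<omega> - elementary_integral B es \<omega>) < e"
    using L2_norm_triangle_diff[OF L(2) ito_L2(2)[OF ito] elementary_L2(2)[OF es(1)], of n]
      L2_norm_minus_commute[of P Z "Y n"] n(2) es(3) by linarith
  ultimately show "\<exists>es. elementary P F es \<and> L2_norm \<nu> (\<lambda>z. g z - eproc es z) < e \<and>
        L2_norm P (\<lambda>\<omega>. Z \<omega> - elementary_integral B es \<omega>) < e"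
    using es(1) by blast
qed

lemma ito_cong_AE:
  assumes "ito f Y" "g \<in> borel_measurable \<nu>" "AE z in \<nu>. f z = g z"
  shows "ito g Y"
proof -
  have g: "g \<in> L2 \<nu>" using L2_cong_AE[OF ito_L2(1)[OF assms(1)] assms(2,3)] .
  have "AE z in \<nu>. f z - g z = 0" using assms(3) by eventually_elim simp
  then have "L2_norm \<nu> (\<lambda>z. f z - g z) = 0"
    by (subst L2_norm_eq_0_iff) (auto intro: L2_diff g ito_L2(1)[OF assms(1)])
  moreover have "L2_norm P (\<lambda>\<omega>. Y \<omega> - Y \<omega>) = 0" by (simp add: L2_norm_def)
  ultimately show ?thesis
    using ito_closed[of "\<lambda>_. f" "\<lambda>_. Y" g Y] assms(1) g ito_L2(2)[OF assms(1)] by simp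
qed

text \<open>By the isometry, convergence of the integrands makes the integrals Cauchy, and a limit
  of the pairs stays in the closed graph.\<close>

lemma ito_exists_limit:
  assumes ito: "\<And>n. \<exists>Y. ito (f n) Y" and g: "g \<in> L2 \<nu>" "(\<lambda>n. L2_norm \<nu> (\<lambda>z. f n z - g z)) \<longlonglongrightarrow> 0"
  shows "\<exists>Z. ito g Z"
proof -
  obtain Y where Y: "\<And>n. ito (f n) (Y n)" using ito by metis
  have "\<exists>N. \<forall>m\<ge>N. \<forall>n\<ge>N. L2_norm P (\<lambda>\<omega>. Y m \<omega> - Y n \<omega>) < e" if "0 < e" for e
    using L2_convergent_Cauchy[OF ito_L2(1)[OF Y] g that] ito_isometry[OF ito_diff[OF Y Y]] by simp
  then obtain Z where "Z \<in> L2 P" "(\<lambda>n. L2_norm P (\<lambda>\<omega>. Y n \<omega> - Z \<omega>)) \<longlonglongrightarrow> 0"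
    using L2_complete[of Y P] ito_L2(2)[OF Y] by blast
  then show ?thesis using ito_closed[OF Y g(1) _ g(2)] by blast
qed

text \<open>The same argument in the opposite direction: convergent integrals have Cauchy
  integrands, and L2(nu) is complete. This permits projecting \<open>H\<close> onto the stochastic
  integrals.\<close>

lemma ito_range_closed: "closed_in_L2 P {Y. \<exists>f. ito f Y}"
  unfolding closed_in_L2_def
proof (intro allI impI, elim conjE)
  fix Y Z assume "\<forall>n::nat. Y n \<in> {Y. \<exists>f. ito f Y}" and Z: "Z \<in> L2 P" "(\<lambda>n. L2_norm P (\<lambda>\<omega>. Y n \<omega> - Z \<omega>)) \<longlonglongrightarrow> 0"
  then have "\<forall>n. \<exists>f. ito f (Y n)" by simp
  then obtain f where f: "\<And>n. ito (f n) (Y n)" by metis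
  have "\<exists>N. \<forall>m\<ge>N. \<forall>n\<ge>N. L2_norm \<nu> (\<lambda>z. f m z - f n z) < e" if "0 < e" for e
    using L2_convergent_Cauchy[OF ito_L2(2)[OF f] Z that] ito_isometry[OF ito_diff[OF f f]] by simp
  then obtain g where "g \<in> L2 \<nu>" "(\<lambda>n. L2_norm \<nu> (\<lambda>z. f n z - g z)) \<longlonglongrightarrow> 0"
    using L2_complete[of f \<nu>] ito_L2(1)[OF f] by blast
  then show "Z \<in> {Y. \<exists>f. ito f Y}" using ito_closed[OF f _ Z(1) _ Z(2)] by blast
qed

lemma ito_zero: "ito (\<lambda>z. 0) (\<lambda>\<omega>. 0)"
  using ito_elementary[of "[]"] by (simp add: eproc_Nil elementary_integral_Nil)

lemma ito_projection:
  assumes "H \<in> L2 P"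
  shows "\<exists>h Y. ito h Y \<and> (\<forall>f Z. ito f Z \<longrightarrow> (LINT \<omega>|P. (H \<omega> - Y \<omega>) * Z \<omega>) = 0)"
proof -
  have "\<exists>Y\<in>{Y. \<exists>f. ito f Y}. \<forall>Z\<in>{Y. \<exists>f. ito f Y}. (LINT \<omega>|P. (H \<omega> - Y \<omega>) * Z \<omega>) = 0"
  proof (rule L2_projection[OF _ _ _ ito_range_closed assms])
    show "(\<lambda>x. a * f x + b * g x) \<in> {Y. \<exists>f. ito f Y}"
      if "f \<in> {Y. \<exists>f. ito f Y}" "g \<in> {Y. \<exists>f. ito f Y}" for f g a b
      using that ito_add[OF ito_scale ito_scale] by blast
  qed (use ito_zero ito_L2(2) in auto)
  then show ?thesis by blast
qed

text \<open>A slice at time 0 is not an elementary process, but it is \<open>\<nu>\<close>-null and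
  so has integral 0. A strip is elementary with coefficient the indicator of its event.\<close>

lemma ito_indicator_rectangle:
  assumes "D \<in> rectangles"
  shows "\<exists>Y. ito (indicator D) Y"
  using assms
proof (cases rule: rectanglesE)
  case (initial A)
  have "D \<in> null_sets \<nu>"
    using rectangle_0[OF initial(2)] emeasure_rectangle_0[OF initial(2)]
    by (auto simp: initial(1) null_sets_def)
  from AE_not_in[OF this] have "AE z in \<nu>. 0 = indicat_real D z"
    by eventually_elim simp
  moreover have "indicator D \<in> borel_measurable \<nu>"
    using rectangle_0[OF initial(2)] by (simp add: initial(1))
  ultimately show ?thesis
    using ito_cong_AE[OF ito_zero] by blast
next
  case (interval s t A)
  have "elementary P F [(s, t, indicator A)]"
    using interval by (auto simp: elementary_def indicator_def intro!: exI[of _ 1])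
  moreover have "eproc [(s, t, indicator A)] = indicator D"
    by (auto simp: eproc_def elementary_process_def interval(1) indicator_def fun_eq_iff)
  ultimately show ?thesis
    using ito_elementary by metis
qed

lemma indicator_L2: "D \<in> sets \<nu> \<Longrightarrow> indicator D \<in> L2 \<nu>"
  by (rule L2_bounded[OF \<nu>.finite_measure_axioms, of _ 1]) (auto simp: indicator_def)

lemma ito_indicator_incseq:
  fixes D :: "nat \<Rightarrow> (real \<times> 'a) set"
  assumes D: "\<And>n. D n \<in> sets \<nu>" "incseq D" and ito: "\<And>n. \<exists>Y. ito (indicator (D n)) Y"
  shows "\<exists>Y. ito (indicator (\<Union>n. D n)) Y"
proof (rule ito_exists_limit[OF ito])
  have U: "(\<Union>n. D n) \<in> sets \<nu>" using D(1) by auto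
  then show "indicator (\<Union>n. D n) \<in> L2 \<nu>" by (rule indicator_L2)
  show "(\<lambda>n. L2_norm \<nu> (\<lambda>z. indicator (D n) z - indicator (\<Union>n. D n) z)) \<longlonglongrightarrow> 0"
  proof (rule L2_dominated_convergence[where b = "\<lambda>_. 1"])
    show "(\<lambda>n. indicator (D n) z :: real) \<longlonglongrightarrow> indicator (\<Union>n. D n) z" for z
      by (rule LIMSEQ_indicator_incseq[OF D(2)])
  qed (use D(1) U in \<open>auto simp: indicator_def L2_def\<close>)
qed

text \<open>Complements in the Dynkin induction are formed as differences from the whole space. As
  time is unbounded, its indicator has to be reached as a limit of strips.\<close>

lemma ito_indicator_UNIV: "\<exists>Y. ito (indicator (space \<nu>)) Y"
proof -
  let ?D = "\<lambda>n. {0} \<times> space P \<union> {0<..real n} \<times> space P"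
  have R: "{0} \<times> space P \<in> rectangles" "{0<..real n} \<times> space P \<in> rectangles" for n
  proof -
    have "(0::real) \<le> 0" "0 \<le> real n" "space P \<in> sets (F 0)" by (auto intro: space_P_F)
    then show "{0} \<times> space P \<in> rectangles" "{0<..real n} \<times> space P \<in> rectangles"
      unfolding rectangles_def by blast+
  qed
  have "\<exists>Y. ito (indicator (\<Union>n. ?D n)) Y"
  proof (rule ito_indicator_incseq)
    show "?D n \<in> sets \<nu>" for n
      by (intro sets.Un rectangle_0 rectangle space_P_F) auto
    show "incseq ?D" by (auto simp: incseq_def)
    show "\<exists>Y. ito (indicator (?D n)) Y" for n
    proof -
      obtain Y Z where "ito (indicator ({0} \<times> space P)) Y" "ito (indicator ({0<..real n} \<times> space P)) Z"
        using ito_indicator_rectangle R by blast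
      then have "ito (\<lambda>z. indicator ({0} \<times> space P) z + indicator ({0<..real n} \<times> space P) z) (\<lambda>\<omega>. Y \<omega> + Z \<omega>)"
        by (rule ito_add)
      moreover have "(\<lambda>z. indicator ({0} \<times> space P) z + indicator ({0<..real n} \<times> space P) z) = indicat_real (?D n)"
        by (auto simp: indicator_def fun_eq_iff)
      ultimately show ?thesis by auto
    qed
  qed
  moreover have "(\<Union>n. ?D n) = space \<nu>"
    using space_\<nu>_Un by auto
  ultimately show ?thesis by simp
qed

lemma ito_indicator:
  assumes "D \<in> sets \<nu>"
  shows "\<exists>Y. ito (indicator D) Y"
proof -
  have "D \<in> sigma_sets ({0..} \<times> space P) rectangles"
    using assms by (simp add: sets_\<nu> sets_predictable)
  with rectangles_Int_stable rectangles_Pow show ?thesis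
  proof (induction rule: sigma_sets_induct_disjoint)
    case (basic A)
    then show ?case by (rule ito_indicator_rectangle)
  next
    case empty
    then show ?case using ito_zero by auto
  next
    case (compl A)
    then have A: "A \<in> sets \<nu>" by (simp add: sets_\<nu> sets_predictable)
    obtain Y Z where "ito (indicator (space \<nu>)) Y" "ito (indicator A) Z"
      using compl ito_indicator_UNIV by blast
    then have "ito (\<lambda>z. indicator (space \<nu>) z - indicator A z) (\<lambda>\<omega>. Y \<omega> - Z \<omega>)"
      by (rule ito_diff)
    moreover have "(\<lambda>z. indicator (space \<nu>) z - indicator A z) = indicat_real ({0..} \<times> space P - A)"
      using sets.sets_into_space[OF A] by (auto simp: indicator_def fun_eq_iff space_\<nu>)
    ultimately show ?case by auto
  next
    case (union A)
    have A: "A n \<in> sets \<nu>" for n using union(2) by (auto simp: sets_\<nu> sets_predictable)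
    \<comment> \<open>Disjointness makes the indicator of a finite union a sum; the countable union
      is then an increasing limit of finite ones.\<close>
    have part: "\<exists>Y. ito (indicator (\<Union>i<n. A i)) Y" for n :: nat
    proof (induction n)
      case 0
      then show ?case using ito_zero by auto
    next
      case (Suc n)
      obtain Y Z where "ito (indicator (\<Union>i<n. A i)) Y" "ito (indicator (A n)) Z"
        using Suc union(3) by blast
      then have "ito (\<lambda>z. indicator (\<Union>i<n. A i) z + indicator (A n) z) (\<lambda>\<omega>. Y \<omega> + Z \<omega>)"
        by (rule ito_add)
      moreover have "(\<lambda>z. indicator (\<Union>i<n. A i) z + indicator (A n) z) = indicat_real (\<Union>i<Suc n. A i)"
      proof
        fix z
        have "z \<notin> A i" if "z \<in> A n" "i < n" for i
          using that disjoint_family_onD[OF union(1), of i n] by auto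
        then show "indicator (\<Union>i<n. A i) z + indicator (A n) z = indicat_real (\<Union>i<Suc n. A i) z"
          by (auto simp: indicator_def less_Suc_eq)
      qed
      ultimately show ?case by auto
    qed
    have "\<exists>Y. ito (indicator (\<Union>n. \<Union>i<n. A i)) Y"
      by (rule ito_indicator_incseq[OF _ _ part]) (use A in \<open>auto simp: incseq_def intro: less_le_trans\<close>)
    moreover have "(\<Union>n. \<Union>i<n. A i) = (\<Union>i. A i)" by auto
    ultimately show ?case by simp
  qed
qed

lemma ito_simple_function:
  fixes f :: "real \<times> 'a \<Rightarrow> real"
  assumes f: "simple_function \<nu> f"
  shows "\<exists>Y. ito f Y"
proof -
  let ?D = "\<lambda>y. f -` {y} \<inter> space \<nu>"
  have D: "?D y \<in> sets \<nu>" for y by (rule simple_functionD(2)[OF f])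
  have sum: "\<exists>Y. ito (\<lambda>z. \<Sum>y\<in>T. y * indicator (?D y) z) Y" if "finite T" for T
    using that
  proof induction
    case empty
    then show ?case using ito_zero by auto
  next
    case (insert y T)
    obtain Y Z where "ito (indicator (?D y)) Y" "ito (\<lambda>z. \<Sum>y\<in>T. y * indicator (?D y) z) Z"
      using insert ito_indicator[OF D] by blast
    from ito_add[OF ito_scale[OF this(1), of y] this(2)] show ?case
      unfolding sum.insert[OF insert(1,2)] by (rule exI[of _ "\<lambda>\<omega>. y * Y \<omega> + Z \<omega>"])
  qed
  have fin: "finite (f ` space \<nu>)" by (rule simple_functionD(1)[OF f])
  obtain Y where Y: "ito (\<lambda>z. \<Sum>y\<in>f ` space \<nu>. y * indicator (?D y) z) Y"
    using sum[OF fin] by blast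
  have "(\<Sum>y\<in>f ` space \<nu>. y * indicator (?D y) z) = f z" if "z \<in> space \<nu>" for z
  proof -
    have "(\<Sum>y\<in>f ` space \<nu>. y * indicator (?D y) z) = (\<Sum>y\<in>f ` space \<nu>. if y = f z then y else 0)"
      using that by (intro sum.cong) (auto simp: indicator_def)
    then show ?thesis using fin that by simp
  qed
  then have "AE z in \<nu>. (\<Sum>y\<in>f ` space \<nu>. y * indicator (?D y) z) = f z" by simp
  then show ?thesis
    using ito_cong_AE[OF Y borel_measurable_simple_function[OF f]] by blast
qed

lemma ito_exists:
  assumes f: "f \<in> L2 \<nu>"
  shows "\<exists>Y. ito f Y"
proof -
  obtain s where "\<forall>i. simple_function \<nu> (s i)" "\<forall>z\<in>space \<nu>. (\<lambda>i. s i z) \<longlonglongrightarrow> f z"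
    "\<forall>i. \<forall>z\<in>space \<nu>. dist (s i z) 0 \<le> 2 * dist (f z) 0"
    using borel_measurable_implies_sequence_metric[OF L2_measurable[OF f], of 0] by blast
  then have s: "\<And>i. simple_function \<nu> (s i)" "\<And>z. z \<in> space \<nu> \<Longrightarrow> (\<lambda>i. s i z) \<longlonglongrightarrow> f z"
    "\<And>i z. z \<in> space \<nu> \<Longrightarrow> \<bar>s i z\<bar> \<le> 2 * \<bar>f z\<bar>"
    by simp_all
  show ?thesis
  proof (rule ito_exists_limit[OF ito_simple_function[OF s(1)] f])
    show "(\<lambda>n. L2_norm \<nu> (\<lambda>z. s n z - f z)) \<longlonglongrightarrow> 0"
    \<comment> \<open>The approximants are bounded by twice the modulus of \<open>f\<close>;
      subtracting \<open>f\<close> costs one more.\<close>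
    proof (rule L2_dominated_convergence[where b = "\<lambda>z. 3 * \<bar>f z\<bar>"])
      show "\<bar>s n z - f z\<bar> \<le> 3 * \<bar>f z\<bar>" if "z \<in> space \<nu>" for n z
        using s(3)[OF that, of n] by linarith
    qed (use f s borel_measurable_simple_function[OF s(1)] in \<open>auto intro: L2_scale L2_abs\<close>)
  qed
qed

text \<open>A function measurable for the completion has a predictable version \<open>g\<close>, and
  integrals over the completion are those over \<open>\<nu>\<close>. Hence the definition says that
  (g, Y) lies in the closed graph, and from here on only \<open>ito\<close> has to be
  handled.\<close>

lemma has_stoch_integral_iff:
  "has_stoch_integral P F B f Y \<longleftrightarrow> (\<exists>g. ito g Y \<and> (AE z in \<nu>. case_prod f z = g z))"
proof
  assume "has_stoch_integral P F B f Y"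
  then obtain es where Y: "Y \<in> L2 P" and fm: "(\<lambda>(t, \<omega>). f t \<omega>) \<in> borel_measurable (completion \<nu>)"
    and es: "\<And>n::nat. elementary P F (es n)"
      "(\<lambda>n. \<integral>\<^sup>+(t, \<omega>). ennreal ((f t \<omega> - elementary_process (es n) t \<omega>)\<^sup>2) \<partial>completion \<nu>) \<longlonglongrightarrow> 0"
      "(\<lambda>n. L2_norm P (\<lambda>\<omega>. Y \<omega> - elementary_integral B (es n) \<omega>)) \<longlonglongrightarrow> 0"
    unfolding has_stoch_integral_def using doleans_unique by blast
  obtain g where g: "g \<in> borel_measurable \<nu>" "AE z in \<nu>. case_prod f z = g z"
    using completion_ex_borel_measurable_real[OF fm] by blast
  have "(\<integral>\<^sup>+(t, \<omega>). ennreal ((f t \<omega> - elementary_process (es n) t \<omega>)\<^sup>2) \<partial>completion \<nu>)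
      = (\<integral>\<^sup>+z. ennreal ((g z - eproc (es n) z)\<^sup>2) \<partial>\<nu>)" for n
    unfolding nn_integral_completion
    by (rule nn_integral_cong_AE) (use g(2) in \<open>eventually_elim, auto simp: eproc_def\<close>)
  with es(2) have lim: "(\<lambda>n. \<integral>\<^sup>+z. ennreal ((g z - eproc (es n) z)\<^sup>2) \<partial>\<nu>) \<longlonglongrightarrow> 0" by simp
  have gm: "(\<lambda>z. g z - eproc (es n) z) \<in> borel_measurable \<nu>" for n
    using g(1) L2_measurable[OF elementary_L2(1)[OF es(1)]] by measurable
  have small: "\<forall>\<^sub>F n in sequentially. (\<integral>\<^sup>+z. ennreal ((g z - eproc (es n) z)\<^sup>2) \<partial>\<nu>) < ennreal (e\<^sup>2)"
    if "0 < e" for e :: real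
    using order_tendstoD(2)[OF lim, of "ennreal (e\<^sup>2)"] that by simp
  \<comment> \<open>The definition does not state that \<open>f\<close> is square integrable; finite
    distance to one elementary process yields this for \<open>g\<close>.\<close>
  obtain n where "(\<integral>\<^sup>+z. ennreal ((g z - eproc (es n) z)\<^sup>2) \<partial>\<nu>) < ennreal (1\<^sup>2)"
    using eventually_happens'[OF sequentially_bot small[of 1]] by auto
  then have "(\<lambda>z. g z - eproc (es n) z) \<in> L2 \<nu>"
    by (intro L2_if_nn_integral gm) (auto intro: less_trans)
  from L2_add[OF this elementary_L2(1)[OF es(1), of n]] have gL: "g \<in> L2 \<nu>" by simp
  have "ito g Y"
    unfolding ito_def
  proof (intro conjI allI impI gL Y)
    fix e :: real assume e: "0 < e"
    have "\<forall>\<^sub>F n in sequentially. (\<integral>\<^sup>+z. ennreal ((g z - eproc (es n) z)\<^sup>2) \<partial>\<nu>) < ennreal (e\<^sup>2) \<and>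
        L2_norm P (\<lambda>\<omega>. Y \<omega> - elementary_integral B (es n) \<omega>) < e"
      by (intro eventually_conj small e order_tendstoD(2)[OF es(3) e])
    then obtain n where n: "(\<integral>\<^sup>+z. ennreal ((g z - eproc (es n) z)\<^sup>2) \<partial>\<nu>) < ennreal (e\<^sup>2)"
        "L2_norm P (\<lambda>\<omega>. Y \<omega> - elementary_integral B (es n) \<omega>) < e"
      using eventually_happens'[OF sequentially_bot] by blast
    have "(L2_norm \<nu> (\<lambda>z. g z - eproc (es n) z))\<^sup>2 < e\<^sup>2"
      using n(1) by (simp add: nn_integral_square_L2[OF L2_diff[OF gL elementary_L2(1)[OF es(1)]]] ennreal_less_iff)
    then have "L2_norm \<nu> (\<lambda>z. g z - eproc (es n) z) < e"
      by (rule power_less_imp_less_base) (use e in simp)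
    then show "\<exists>es. elementary P F es \<and> L2_norm \<nu> (\<lambda>z. g z - eproc es z) < e \<and>
        L2_norm P (\<lambda>\<omega>. Y \<omega> - elementary_integral B es \<omega>) < e"
      using es(1) n(2) by blast
  qed
  with g(2) show "\<exists>g. ito g Y \<and> (AE z in \<nu>. case_prod f z = g z)" by blast
next
  assume "\<exists>g. ito g Y \<and> (AE z in \<nu>. case_prod f z = g z)"
  then obtain g where g: "ito g Y" "AE z in \<nu>. case_prod f z = g z" by blast
  have "\<exists>es. elementary P F es \<and> L2_norm \<nu> (\<lambda>z. g z - eproc es z) < inverse (real (Suc n)) \<and>
        L2_norm P (\<lambda>\<omega>. Y \<omega> - elementary_integral B es \<omega>) < inverse (real (Suc n))" for n
    using g(1) unfolding ito_def by simp
  then obtain es where es: "\<And>n. elementary P F (es n)"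
    "\<And>n. L2_norm \<nu> (\<lambda>z. g z - eproc (es n) z) < inverse (real (Suc n))"
    "\<And>n. L2_norm P (\<lambda>\<omega>. Y \<omega> - elementary_integral B (es n) \<omega>) < inverse (real (Suc n))"
    by metis
  have lim: "(\<lambda>n. L2_norm \<nu> (\<lambda>z. g z - eproc (es n) z)) \<longlonglongrightarrow> 0"
    "(\<lambda>n. L2_norm P (\<lambda>\<omega>. Y \<omega> - elementary_integral B (es n) \<omega>)) \<longlonglongrightarrow> 0"
    by (rule tendsto_sandwich[OF _ _ tendsto_const LIMSEQ_inverse_real_of_nat];
        use es in \<open>auto intro!: always_eventually less_imp_le\<close>)+
  have "(\<integral>\<^sup>+(t, \<omega>). ennreal ((f t \<omega> - elementary_process (es n) t \<omega>)\<^sup>2) \<partial>completion \<nu>)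
      = ennreal ((L2_norm \<nu> (\<lambda>z. g z - eproc (es n) z))\<^sup>2)" for n
  proof -
    have "(\<integral>\<^sup>+(t, \<omega>). ennreal ((f t \<omega> - elementary_process (es n) t \<omega>)\<^sup>2) \<partial>completion \<nu>)
        = (\<integral>\<^sup>+z. ennreal ((g z - eproc (es n) z)\<^sup>2) \<partial>\<nu>)"
      unfolding nn_integral_completion
      by (rule nn_integral_cong_AE) (use g(2) in \<open>eventually_elim, auto simp: eproc_def\<close>)
    then show ?thesis
      by (simp add: nn_integral_square_L2[OF L2_diff[OF ito_L2(1)[OF g(1)] elementary_L2(1)[OF es(1)]]])
  qed
  moreover have "(\<lambda>n. ennreal ((L2_norm \<nu> (\<lambda>z. g z - eproc (es n) z))\<^sup>2)) \<longlonglongrightarrow> ennreal (0\<^sup>2)"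
    by (intro tendsto_intros lim(1))
  ultimately have "(\<lambda>n. \<integral>\<^sup>+(t, \<omega>). ennreal ((f t \<omega> - elementary_process (es n) t \<omega>)\<^sup>2) \<partial>completion \<nu>) \<longlonglongrightarrow> 0"
    by simp
  moreover have "(\<lambda>(t, \<omega>). f t \<omega>) \<in> borel_measurable (completion \<nu>)"
    using borel_measurable_completion_AE[OF L2_measurable[OF ito_L2(1)[OF g(1)]] g(2)] by simp
  ultimately show "has_stoch_integral P F B f Y"
    unfolding has_stoch_integral_def using doleans es(1) lim(2) ito_L2(2)[OF g(1)] by blast
qed

end

section \<open>Projection onto the range of the nonlinear integral\<close>

lemma stoch_integrableD:
  "stoch_integrable P F B f \<Longrightarrow> has_stoch_integral P F B f (stoch_integral P F B f)"
  unfolding stoch_integrable_def stoch_integral_def by (rule someI_ex[of "has_stoch_integral P F B f"])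

theorem theorem5:
  fixes P :: "'a measure" and F :: "real \<Rightarrow> 'a measure"
    and M :: "real \<Rightarrow> real \<Rightarrow> 'a \<Rightarrow> real" and M_inf :: "real \<Rightarrow> 'a \<Rightarrow> real"
    and \<delta> K :: "'a \<Rightarrow> real"
    and B :: "real \<Rightarrow> 'a \<Rightarrow> real" and \<mu> :: "real \<Rightarrow> real \<Rightarrow> 'a \<Rightarrow> real"
    and H :: "'a \<Rightarrow> real"
  assumes "filtered_prob_space P F"
    and "\<And>x. M x \<in> M2_0 P F"
    and "\<And>x. terminal_value P (M x) (M_inf x)"
    and "\<delta> \<in> borel_measurable P" and "AE \<omega> in P. \<delta> \<omega> > 0"
    and "K \<in> L2 P" and "AE \<omega> in P. K \<omega> > 0"
    and "AE \<omega> in P. (\<lambda>x. M_inf x \<omega>) \<in> Hoelder_class 1 (\<delta> \<omega>) (K \<omega>)"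
    and "B \<in> M2_0 P F"
    and "\<And>x. predictable P F (\<mu> x)"
    and "AE \<omega> in P. \<forall>t\<ge>0. C_class 1 (\<lambda>x. \<mu> x t \<omega>)"
    and "\<And>x. has_stoch_integral P F B (\<mu> x) (M_inf x)"
    and "\<And>x. has_stoch_integral P F B (dx \<mu> x) (\<lambda>\<omega>. deriv (\<lambda>y. M_inf y \<omega>) x)"
    and "H \<in> L2_0 P"
    and "closed_in_L2 P (nl_range P F B \<mu>)"
  shows "\<exists>\<theta>\<in>admissible P F B \<mu>. \<exists>L.
           (\<forall>\<omega>\<in>space P. H \<omega> = nl_integral P F B \<mu> \<theta> \<omega> + L \<omega>) \<and>
           (LINT \<omega>|P. L \<omega> * nl_integral P F B (dx \<mu>) \<theta> \<omega>) = 0 \<and>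
           (LINT \<omega>|P. (H \<omega> - nl_integral P F B \<mu> \<theta> \<omega>) * nl_integral P F B (dx \<mu>) \<theta> \<omega>) = 0 \<and>
           L2_norm P (\<lambda>\<omega>. H \<omega> - nl_integral P F B \<mu> \<theta> \<omega>)
             = (INF X\<in>nl_range P F B \<mu>. L2_norm P (\<lambda>\<omega>. H \<omega> - X \<omega>))"
proof -
  interpret filtered_prob_space P F by fact
  \<comment> \<open>The representation of a single member of the family supplies the measure; by
    uniqueness all other integrals use the same one.\<close>
  obtain \<nu> where \<nu>: "doleans_measure P F B \<nu>"
    using assms(12)[of 0] by (auto simp: has_stoch_integral_def)
  interpret ito_integrator P F B \<nu>
    by standard (use assms(9) \<nu> in auto)
  obtain N\<^sub>0 where N0: "\<And>\<omega>. \<omega> \<in> space P - N\<^sub>0 \<Longrightarrow> \<forall>t\<ge>0. C_class 1 (\<lambda>x. \<mu> x t \<omega>)" "N\<^sub>0 \<in> null_sets P"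
    by (rule AE_E3[OF assms(11)]) blast
  have good: "(\<forall>x. ((\<lambda>y. \<mu> y t \<omega>) has_real_derivative dx \<mu> x t \<omega>) (at x)) \<and> continuous_on UNIV (\<lambda>x. dx \<mu> x t \<omega>)"
    if "0 \<le> t" "\<omega> \<in> space P" "\<omega> \<notin> N\<^sub>0" for t \<omega>
  proof -
    have "C_class 1 (\<lambda>x. \<mu> x t \<omega>)" using N0(1) that by blast
    then show ?thesis
      by (auto simp: C_class_def dx_def real_differentiable_def DERIV_deriv_iff_real_differentiable)
  qed
  \<comment> \<open>The zero family is trivially smooth, so this makes the smoothness conditions
    hold at every point, while the change is confined to a \<open>\<nu>\<close>-null predictable
    set.\<close>
  define m where "m x z = (if snd z \<in> N\<^sub>0 then 0 else \<mu> x (fst z) (snd z))" for x z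
  define d where "d x z = (if snd z \<in> N\<^sub>0 then 0 else dx \<mu> x (fst z) (snd z))" for x z
  have predictable_iff: "predictable P F \<theta> \<longleftrightarrow> case_prod \<theta> \<in> borel_measurable \<nu>" for \<theta>
    unfolding predictable_def measurable_cong_sets[OF sets_\<nu> refl] ..
  interpret smooth_family \<nu> m d
  proof
    have "{z \<in> space \<nu>. snd z \<in> N\<^sub>0} = {0..} \<times> N\<^sub>0"
      using N0(2) sets.sets_into_space[of N\<^sub>0 P] by (auto simp: space_\<nu> null_sets_def)
    also have "\<dots> \<in> sets \<nu>" using null_evanescent[OF N0(2)] by auto
    finally have "{z \<in> space \<nu>. snd z \<in> N\<^sub>0} \<in> sets \<nu>" .
    moreover have "(\<lambda>z. \<mu> x (fst z) (snd z)) \<in> borel_measurable \<nu>" for x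
      using assms(10)[of x] unfolding predictable_iff by (simp add: case_prod_beta')
    ultimately show "m x \<in> borel_measurable \<nu>" for x
      unfolding m_def by (intro measurable_If) auto
    show "((\<lambda>y. m y z) has_real_derivative d x z) (at x)" if "z \<in> space \<nu>" for z x
      using that good[of "fst z" "snd z"] by (cases "snd z \<in> N\<^sub>0") (auto simp: m_def d_def space_\<nu>)
    show "continuous_on UNIV (\<lambda>x. d x z)" if "z \<in> space \<nu>" for z
      using that good[of "fst z" "snd z"] by (cases "snd z \<in> N\<^sub>0") (auto simp: d_def space_\<nu>)
  qed
  have AE_N0: "AE z in \<nu>. snd z \<notin> N\<^sub>0"
    using AE_evanescent[OF AE_not_in[OF N0(2)]] by (simp add: case_prod_beta')
  have AE_m: "AE z in \<nu>. case_prod (nl_integrand \<mu> \<theta>) z = m (case_prod \<theta> z) z" for \<theta>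
    using AE_N0 by eventually_elim (auto simp: nl_integrand_def m_def case_prod_beta')
  have AE_d: "AE z in \<nu>. case_prod (nl_integrand (dx \<mu>) \<theta>) z = d (case_prod \<theta> z) z" for \<theta>
    using AE_N0 by eventually_elim (auto simp: nl_integrand_def d_def case_prod_beta')
  \<comment> \<open>Any predictable function almost everywhere equal to the process may serve as
    integrand, in particular \<open>m\<close> and \<open>d\<close> composed with a predictable
    parameter.\<close>
  have ito_of_stoch: "ito g Y"
    if f: "has_stoch_integral P F B f Y" and fg: "AE z in \<nu>. case_prod f z = g z"
      and g: "g \<in> borel_measurable \<nu>" for f Y g
  proof -
    obtain g' where g': "ito g' Y" "AE z in \<nu>. case_prod f z = g' z"
      using f unfolding has_stoch_integral_iff by blast
    have "AE z in \<nu>. g' z = g z" using g'(2) fg by eventually_elim simp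
    then show ?thesis by (rule ito_cong_AE[OF g'(1) g])
  qed
  have adm_ito: "ito (\<lambda>z. m (case_prod \<theta> z) z) (nl_integral P F B \<mu> \<theta>)"
    "ito (\<lambda>z. d (case_prod \<theta> z) z) (nl_integral P F B (dx \<mu>) \<theta>)"
    if "\<theta> \<in> admissible P F B \<mu>" for \<theta>
  proof -
    have \<theta>: "case_prod \<theta> \<in> borel_measurable \<nu>" "stoch_integrable P F B (nl_integrand \<mu> \<theta>)"
      "stoch_integrable P F B (nl_integrand (dx \<mu>) \<theta>)"
      using that by (auto simp: admissible_def predictable_iff)
    have "has_stoch_integral P F B (nl_integrand \<mu> \<theta>) (nl_integral P F B \<mu> \<theta>)"
      "has_stoch_integral P F B (nl_integrand (dx \<mu>) \<theta>) (nl_integral P F B (dx \<mu>) \<theta>)"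
      using \<theta>(2,3)[THEN stoch_integrableD] unfolding nl_integral_def .
    then show "ito (\<lambda>z. m (case_prod \<theta> z) z) (nl_integral P F B \<mu> \<theta>)"
      "ito (\<lambda>z. d (case_prod \<theta> z) z) (nl_integral P F B (dx \<mu>) \<theta>)"
      using ito_of_stoch[OF _ AE_m m_comp_measurable[OF \<theta>(1)]] ito_of_stoch[OF _ AE_d d_comp_measurable[OF \<theta>(1)]]
      by auto
  qed
  have admissible_adm: "case_prod \<theta> \<in> adm" if "\<theta> \<in> admissible P F B \<mu>" for \<theta>
    using that adm_ito[OF that, THEN ito_L2(1)] by (auto simp: adm_def admissible_def predictable_iff)
  \<comment> \<open>This direction rests on \<open>ito_exists\<close>: square integrability of the
    two compositions already produces both integrals.\<close>
  have adm_admissible: "curry \<theta> \<in> admissible P F B \<mu>" if \<theta>: "\<theta> \<in> adm" for \<theta>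
  proof -
    obtain Y Z where "ito (\<lambda>z. m (\<theta> z) z) Y" "ito (\<lambda>z. d (\<theta> z) z) Z"
      using \<theta> ito_exists by (auto simp: adm_def) blast
    then have "has_stoch_integral P F B (nl_integrand \<mu> (curry \<theta>)) Y"
      "has_stoch_integral P F B (nl_integrand (dx \<mu>) (curry \<theta>)) Z"
      using AE_m[of "curry \<theta>"] AE_d[of "curry \<theta>"] unfolding has_stoch_integral_iff by auto
    then show ?thesis
      using \<theta> by (auto simp: admissible_def stoch_integrable_def predictable_iff adm_def)
  qed
  \<comment> \<open>The constant parameter 0 turns the integrands into \<open>\<mu> 0\<close> and
    \<open>dx \<mu> 0\<close>, whose integrals exist by hypothesis.\<close>
  have "(\<lambda>t \<omega>. 0) \<in> admissible P F B \<mu>"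
    using assms(12)[of 0] assms(13)[of 0]
    by (auto simp: admissible_def predictable_iff stoch_integrable_def nl_integrand_def[abs_def])
  then have ne: "adm \<noteq> {}" using admissible_adm by blast
  \<comment> \<open>Closedness is carried across the isometry and back: the integrals converge to
    the integral \<open>W\<close> of the limit \<open>g\<close>, closedness of
    \<open>nl_range\<close> supplies a parameter for \<open>W\<close>, and the isometry forces
    \<open>g\<close> to be the integrand of that parameter almost everywhere.\<close>
  have closed: "closed_in_L2 \<nu> rng"
    unfolding closed_in_L2_def
  proof (intro allI impI, elim conjE)
    fix X g assume "\<forall>n::nat. X n \<in> rng" and g: "g \<in> L2 \<nu>" "(\<lambda>n. L2_norm \<nu> (\<lambda>z. X n z - g z)) \<longlonglongrightarrow> 0"
    then have "\<forall>n. \<exists>\<theta>. X n \<in> L2 \<nu> \<and> \<theta> \<in> adm \<and> (AE z in \<nu>. X n z = m (\<theta> z) z)"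
      by (auto simp: rng_def)
    then obtain \<theta> where \<theta>: "\<And>n. X n \<in> L2 \<nu>" "\<And>n. \<theta> n \<in> adm" "\<And>n. AE z in \<nu>. X n z = m (\<theta> n z) z"
      by metis
    let ?W = "\<lambda>n. nl_integral P F B \<mu> (curry (\<theta> n))"
    have X: "ito (X n) (?W n)" for n
    proof (rule ito_cong_AE)
      show "ito (\<lambda>z. m (\<theta> n z) z) (?W n)"
        using adm_ito(1)[OF adm_admissible[OF \<theta>(2)], of n] by simp
      show "AE z in \<nu>. m (\<theta> n z) z = X n z" using \<theta>(3)[of n] by eventually_elim simp
    qed (rule L2_measurable[OF \<theta>(1)])
    obtain W where W: "ito g W" using ito_exists[OF g(1)] by blast
    have "(\<lambda>n. L2_norm P (\<lambda>\<omega>. ?W n \<omega> - W \<omega>)) \<longlonglongrightarrow> 0"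
      using g(2) ito_isometry[OF ito_diff[OF X W]] by simp
    moreover have "?W n \<in> nl_range P F B \<mu>" for n
      using ito_L2(2)[OF X] adm_admissible[OF \<theta>(2)] by (auto simp: nl_range_def)
    ultimately have "W \<in> nl_range P F B \<mu>"
      using closed_in_L2D[OF assms(15) _ ito_L2(2)[OF W], of ?W] by blast
    then obtain \<eta> where \<eta>: "\<eta> \<in> admissible P F B \<mu>" "AE \<omega> in P. W \<omega> = nl_integral P F B \<mu> \<eta> \<omega>"
      by (auto simp: nl_range_def)
    note diff = ito_diff[OF W adm_ito(1)[OF \<eta>(1)]]
    have "L2_norm P (\<lambda>\<omega>. W \<omega> - nl_integral P F B \<mu> \<eta> \<omega>) = 0"
      using \<eta>(2) by (subst L2_norm_eq_0_iff[OF ito_L2(2)[OF diff]]) simp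
    then have "AE z in \<nu>. g z - m (case_prod \<eta> z) z = 0"
      using ito_isometry[OF diff] L2_norm_eq_0_iff[OF ito_L2(1)[OF diff]] by simp
    then show "g \<in> rng"
      using g(1) admissible_adm[OF \<eta>(1)] unfolding rng_def by auto
  qed
  have H: "H \<in> L2 P" using assms(14) by (simp add: L2_0_def)
  obtain h Y where h: "ito h Y" and orth: "\<And>f Z. ito f Z \<Longrightarrow> (LINT \<omega>|P. (H \<omega> - Y \<omega>) * Z \<omega>) = 0"
    using ito_projection[OF H] by blast
  obtain \<theta>' where \<theta>': "\<theta>' \<in> adm" "AE z in \<nu>. (h z - m (\<theta>' z) z) * d (\<theta>' z) z = 0"
    "\<And>\<eta>. \<eta> \<in> adm \<Longrightarrow> L2_norm \<nu> (\<lambda>z. h z - m (\<theta>' z) z) \<le> L2_norm \<nu> (\<lambda>z. h z - m (\<eta> z) z)"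
    using nearest_exists[OF ito_L2(1)[OF h] ne closed] by blast
  define \<theta> where "\<theta> = curry \<theta>'"
  have \<theta>: "\<theta> \<in> admissible P F B \<mu>" and [simp]: "case_prod \<theta> = \<theta>'"
    using adm_admissible[OF \<theta>'(1)] by (auto simp: \<theta>_def)
  let ?I = "nl_integral P F B \<mu>" and ?J = "nl_integral P F B (dx \<mu>) \<theta>"
  have HY: "(\<lambda>\<omega>. H \<omega> - Y \<omega>) \<in> L2 P" by (intro L2_diff H ito_L2(2)[OF h])
  \<comment> \<open>The difference of \<open>Y\<close> and the nonlinear integral is again a
    stochastic integral, hence orthogonal to \<open>H - Y\<close>. So approximating \<open>H\<close>
    in L2(P) and \<open>h\<close> in L2(nu) have the same minimisers.\<close>
  have pythagoras: "(L2_norm P (\<lambda>\<omega>. H \<omega> - ?I \<eta> \<omega>))\<^sup>2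
      = (L2_norm P (\<lambda>\<omega>. H \<omega> - Y \<omega>))\<^sup>2 + (L2_norm \<nu> (\<lambda>z. h z - m (case_prod \<eta> z) z))\<^sup>2"
    if "\<eta> \<in> admissible P F B \<mu>" for \<eta>
  proof -
    note diff = ito_diff[OF h adm_ito(1)[OF that]]
    show ?thesis
      using L2_norm_add_sq[OF HY ito_L2(2)[OF diff]] orth[OF diff] ito_isometry[OF diff] by simp
  qed
  have min: "L2_norm P (\<lambda>\<omega>. H \<omega> - ?I \<theta> \<omega>) \<le> L2_norm P (\<lambda>\<omega>. H \<omega> - ?I \<eta> \<omega>)"
    if "\<eta> \<in> admissible P F B \<mu>" for \<eta>
  proof (rule power2_le_imp_le)
    show "(L2_norm P (\<lambda>\<omega>. H \<omega> - ?I \<theta> \<omega>))\<^sup>2 \<le> (L2_norm P (\<lambda>\<omega>. H \<omega> - ?I \<eta> \<omega>))\<^sup>2"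
      using \<theta>'(3)[OF admissible_adm[OF that]] unfolding pythagoras[OF that] pythagoras[OF \<theta>]
      by (simp add: power_mono)
  qed simp
  \<comment> \<open>\<open>?J\<close> is a stochastic integral, so the part from
    \<open>H - Y\<close> vanishes; the rest is, by the polarised isometry, the integral of a
    function that is 0 almost everywhere.\<close>
  have zero: "(LINT \<omega>|P. (H \<omega> - ?I \<theta> \<omega>) * ?J \<omega>) = 0"
  proof -
    note J = adm_ito(2)[OF \<theta>] and diff = ito_diff[OF h adm_ito(1)[OF \<theta>]]
    have "(LINT \<omega>|P. (H \<omega> - ?I \<theta> \<omega>) * ?J \<omega>)
        = (LINT \<omega>|P. (H \<omega> - Y \<omega>) * ?J \<omega> + (Y \<omega> - ?I \<theta> \<omega>) * ?J \<omega>)"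
      by (simp add: algebra_simps)
    also have "\<dots> = (LINT \<omega>|P. (H \<omega> - Y \<omega>) * ?J \<omega>) + (LINT \<omega>|P. (Y \<omega> - ?I \<theta> \<omega>) * ?J \<omega>)"
      by (intro Bochner_Integration.integral_add L2_mult_integrable HY ito_L2(2)[OF J] ito_L2(2)[OF diff])
    also have "(LINT \<omega>|P. (Y \<omega> - ?I \<theta> \<omega>) * ?J \<omega>) = (LINT z|\<nu>. (h z - m (\<theta>' z) z) * d (\<theta>' z) z)"
      using ito_inner[OF diff J] by simp
    also have "\<dots> = 0"
      using \<theta>'(2) by (rule integral_eq_zero_AE)
    finally show ?thesis using orth[OF J] by simp
  qed
  have I_range: "?I \<theta> \<in> nl_range P F B \<mu>"
    using \<theta> ito_L2(2)[OF adm_ito(1)[OF \<theta>]] by (auto simp: nl_range_def)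
  have "(INF X\<in>nl_range P F B \<mu>. L2_norm P (\<lambda>\<omega>. H \<omega> - X \<omega>)) = L2_norm P (\<lambda>\<omega>. H \<omega> - ?I \<theta> \<omega>)"
  proof (rule cInf_eq_minimum)
    show "L2_norm P (\<lambda>\<omega>. H \<omega> - ?I \<theta> \<omega>) \<in> (\<lambda>X. L2_norm P (\<lambda>\<omega>. H \<omega> - X \<omega>)) ` nl_range P F B \<mu>"
      using I_range by blast
    fix y assume "y \<in> (\<lambda>X. L2_norm P (\<lambda>\<omega>. H \<omega> - X \<omega>)) ` nl_range P F B \<mu>"
    then obtain X \<eta> where X: "y = L2_norm P (\<lambda>\<omega>. H \<omega> - X \<omega>)" "X \<in> L2 P" "\<eta> \<in> admissible P F B \<mu>"
      "AE \<omega> in P. X \<omega> = ?I \<eta> \<omega>"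
      by (auto simp: nl_range_def)
    \<comment> \<open>Members of \<open>nl_range\<close> are integrals only up to almost sure
      equality, which leaves the distance unchanged.\<close>
    have "y = L2_norm P (\<lambda>\<omega>. H \<omega> - ?I \<eta> \<omega>)"
      unfolding X(1)
    proof (rule L2_norm_cong_AE)
      show "AE \<omega> in P. H \<omega> - X \<omega> = H \<omega> - ?I \<eta> \<omega>" using X(4) by eventually_elim simp
    qed (intro L2_measurable[OF L2_diff] H X(2) ito_L2(2)[OF adm_ito(1)[OF X(3)]])+
    then show "L2_norm P (\<lambda>\<omega>. H \<omega> - ?I \<theta> \<omega>) \<le> y"
      using min[OF X(3)] by simp
  qed
  with \<theta> zero show ?thesis
    by (intro bexI[of _ \<theta>] exI[of _ "\<lambda>\<omega>. H \<omega> - ?I \<theta> \<omega>"]) auto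
qed

end
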